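(* Let $G$ be a discrete group with a length function $\ell:G\to\mathbb{N}_0$ such that $\ell^{-1}(0)=\{e\}$, $\ell$ is proper, and $G$ is of rapid decay with respect to $\ell$. Then there exists $k_0\in\mathbb{N}$ such that for all $k\ge k_0$: the seminorm $L_D^k$ on $C^*_r(G)$ is lower semicontinuous, the metric $$d_k(\varphi,\psi)=\sup\{|\varphi(a)-\psi(a)| \; : \; a\in \mathrm{domain}(L_D^k),\ L_D^k(a)\le 1\}$$ generated by $L_D^k$ on the state space $\mathcal{S}(C^*_r(G))$ is bounded, and the topology generated by this metric equals the w*-topology on $\mathcal{S}(C^*_r(G))$.
   Context: A length function on a group $G$ is a map $\ell:G\to[0,\infty)$ with $\ell(e)=0$, $\ell(gh)\le\ell(g)+\ell(h)$ and $\ell(g)=\ell(g^{-1})$ for all $g,h\in G$. It is proper if $\ell^{-1}([0,c])$ is finite for each $c>0$. For a discrete group $G$, $\lambda$ denotes the left regular representation on $l^2(G)$, and for $x\in\mathbb{C}G$, $\lambda(x)=\sum_g x(g)\lambda_g$; $C^*_r(G)\subseteq B(l^2(G))$ is the C*-algebra generated by $\lambda(\mathbb{C}G)$. $G$ is of rapid decay with respect to $\ell$ if there exist positive reals $C,s$ such that $\|\lambda(x)\|\le C\big(\sum_{g\in G}(1+\ell(g))^{2s}|x(g)|^2\big)^{1/2}$ for all $x\in\mathbb{C}G$. The Dirac operator $D$ is the self-adjoint operator on $l^2(G)$ given by $(D\xi)(g)=\ell(g)\xi(g)$ on its natural domain $\mathrm{dom}(D)$. For $a\in B(l^2(G))$,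 say that $[D,a]$ is bounded if $a(\mathrm{dom}(D))\subseteq \mathrm{dom}(D)$ and $Da-aD$ is bounded on $\mathrm{dom}(D)$; then $\delta(a)\in B(l^2(G))$ denotes the bounded extension (closure) of $[D,a]$. For $k\in\mathbb{N}$ (here $k\geq 1$), $\mathrm{domain}(L_D^k)$ is the set of $a\in C^*_r(G)$ for which the $k$-fold iterated commutator $\delta^k(a)=\delta(\delta(\cdots\delta(a)\cdots))$ is defined (that is, with $\delta^0(a)=a$, for each $j=0,\dots,k-1$ the operator $\delta^j(a)$ maps $\mathrm{dom}(D)$ into $\mathrm{dom}(D)$ and $D\delta^j(a)-\delta^j(a)D$ is bounded on $\mathrm{dom}(D)$), and $L_D^k(a)=\|\delta^k(a)\|$. Lower semicontinuity of $L_D^k$ means that the set $\{a\in C^*_r(G) : a\in\mathrm{domain}(L_D^k),\ L_D^k(a)\le 1\}$ is norm closed in $C^*_r(G)$. *)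

theory Defs
  imports "HOL-Analysis.Analysis" "HOL-Library.Poly_Mapping" "HOL-Library.Nonpos_Ints"
begin

text \<open>
  Groups are types of class \<^class>\<open>group_add\<close>, which is not assumed commutative.  The group
  operation is thus written \<open>g + h\<close>, the neutral element \<open>0\<close> and the inverse \<open>- g\<close>.  With these
  conventions the group algebra \<open>\<complex>G\<close> is the type \<open>'g \<Rightarrow>\<^sub>0 complex\<close>.
\<close>

section \<open>The Hilbert space of square summable functions\<close>

typedef 'a l2 = "{f :: 'a \<Rightarrow> complex. (\<lambda>x. (cmod (f x))\<^sup>2) summable_on UNIV}"
  morphisms l2_apply Abs_l2
  by (rule exI[of _ "\<lambda>_. 0"]) simp

setup_lifting type_definition_l2

lemma l2_summable_mult:
  fixes f g :: "'a \<Rightarrow> complex"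
  assumes "(\<lambda>x. (cmod (f x))\<^sup>2) summable_on UNIV" "(\<lambda>x. (cmod (g x))\<^sup>2) summable_on UNIV"
  shows "(\<lambda>x. f x * cnj (g x)) summable_on UNIV"
proof -
  have "(\<lambda>x. (cmod (f x))\<^sup>2 + (cmod (g x))\<^sup>2) summable_on UNIV"
    by (intro summable_on_add assms)
  then have "(\<lambda>x. norm (f x * cnj (g x))) summable_on UNIV"
  proof (rule Infinite_Sum.abs_summable_on_comparison_test')
    fix x
    have "cmod (f x) * cmod (g x) * 2 \<le> (cmod (f x))\<^sup>2 + (cmod (g x))\<^sup>2"
      using sum_squares_bound[of "cmod (f x)" "cmod (g x)"] by simp
    moreover have "0 \<le> cmod (f x) * cmod (g x)" by simp
    ultimately show "norm (f x * cnj (g x)) \<le> (cmod (f x))\<^sup>2 + (cmod (g x))\<^sup>2"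
      by (simp only: norm_mult complex_mod_cnj)
  qed
  then show ?thesis
    by (rule abs_summable_summable)
qed

lemma l2_summable_scale:
  fixes f :: "'a \<Rightarrow> complex"
  assumes "(\<lambda>x. (cmod (f x))\<^sup>2) summable_on UNIV"
  shows "(\<lambda>x. (cmod (c * f x))\<^sup>2) summable_on UNIV"
  using summable_on_cmult_right[OF assms, of "(cmod c)\<^sup>2"] by (simp add: norm_mult power_mult_distrib)

lemma l2_summable_add:
  fixes f g :: "'a \<Rightarrow> complex"
  assumes f: "(\<lambda>x. (cmod (f x))\<^sup>2) summable_on UNIV" and g: "(\<lambda>x. (cmod (g x))\<^sup>2) summable_on UNIV"
  shows "(\<lambda>x. (cmod (f x + g x))\<^sup>2) summable_on UNIV"
proof (rule summable_on_comparison_test)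
  show "(\<lambda>x. 2 * (cmod (f x))\<^sup>2 + 2 * (cmod (g x))\<^sup>2) summable_on UNIV"
    by (intro summable_on_add summable_on_cmult_right f g)
  fix x
  have "(cmod (f x + g x))\<^sup>2 \<le> (cmod (f x) + cmod (g x))\<^sup>2"
    by (simp add: norm_triangle_ineq)
  also have "\<dots> \<le> 2 * (cmod (f x))\<^sup>2 + 2 * (cmod (g x))\<^sup>2"
    using sum_squares_bound[of "cmod (f x)" "cmod (g x)"] by (simp add: power2_sum)
  finally show "(cmod (f x + g x))\<^sup>2 \<le> 2 * (cmod (f x))\<^sup>2 + 2 * (cmod (g x))\<^sup>2" .
qed auto

lemma l2_summable_diff:
  fixes f g :: "'a \<Rightarrow> complex"
  assumes "(\<lambda>x. (cmod (f x))\<^sup>2) summable_on UNIV" "(\<lambda>x. (cmod (g x))\<^sup>2) summable_on UNIV"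
  shows "(\<lambda>x. (cmod (f x - g x))\<^sup>2) summable_on UNIV"
  using l2_summable_add[of f "\<lambda>x. - g x"] assms by simp

instantiation l2 :: (type) real_vector
begin

lift_definition zero_l2 :: "'a l2" is "\<lambda>_. 0" by simp

lift_definition plus_l2 :: "'a l2 \<Rightarrow> 'a l2 \<Rightarrow> 'a l2" is "\<lambda>f g x. f x + g x"
  by (simp add: l2_summable_add)

lift_definition uminus_l2 :: "'a l2 \<Rightarrow> 'a l2" is "\<lambda>f x. - f x" by simp

lift_definition minus_l2 :: "'a l2 \<Rightarrow> 'a l2 \<Rightarrow> 'a l2" is "\<lambda>f g x. f x - g x"
  by (simp add: l2_summable_diff)

lift_definition scaleR_l2 :: "real \<Rightarrow> 'a l2 \<Rightarrow> 'a l2" is "\<lambda>r f x. complex_of_real r * f x"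
  by (simp only: mem_Collect_eq l2_summable_scale)

instance
  by standard (transfer; simp add: fun_eq_iff algebra_simps)+

end

lift_definition cinner :: "'a l2 \<Rightarrow> 'a l2 \<Rightarrow> complex" is "\<lambda>f g. \<Sum>\<^sub>\<infinity>x. f x * cnj (g x)" .

lemma l2_cinner_summable: "(\<lambda>x. l2_apply f x * cnj (l2_apply g x)) summable_on UNIV"
  using l2_apply[of f] l2_apply[of g] by (intro l2_summable_mult) simp_all

lemma cinner_add_left: "cinner (f + g) h = cinner f h + cinner g h"
  by (simp add: cinner.rep_eq plus_l2.rep_eq distrib_right infsum_add l2_cinner_summable)

lemma cinner_scaleR_left: "cinner (r *\<^sub>R f) h = r * cinner f h"
  by (simp add: cinner.rep_eq scaleR_l2.rep_eq mult.assoc infsum_cmult_right')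

lemma cinner_commute: "cinner g f = cnj (cinner f g)"
  by (simp add: cinner.rep_eq mult.commute flip: infsum_cnj)

lemma l2_cinner_self: "cinner f f = of_real (\<Sum>\<^sub>\<infinity>x. (cmod (l2_apply f x))\<^sup>2)"
proof -
  have "cinner f f = (\<Sum>\<^sub>\<infinity>x. of_real ((cmod (l2_apply f x))\<^sup>2))"
    by (simp only: cinner.rep_eq complex_norm_square)
  also have "\<dots> = of_real (\<Sum>\<^sub>\<infinity>x. (cmod (l2_apply f x))\<^sup>2)"
    using l2_apply[of f]
    by (intro infsumI has_sum_of_real has_sum_infsum) simp
  finally show ?thesis .
qed

instantiation l2 :: (type) real_inner
begin

definition inner_l2 :: "'a l2 \<Rightarrow> 'a l2 \<Rightarrow> real" where
  "inner_l2 f g = Re (cinner f g)"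

definition norm_l2 :: "'a l2 \<Rightarrow> real" where
  "norm_l2 f = sqrt (\<Sum>\<^sub>\<infinity>x. (cmod (l2_apply f x))\<^sup>2)"

definition sgn_l2 :: "'a l2 \<Rightarrow> 'a l2" where "sgn_l2 f = inverse (norm f) *\<^sub>R f"

definition dist_l2 :: "'a l2 \<Rightarrow> 'a l2 \<Rightarrow> real" where "dist_l2 f g = norm (f - g)"

definition uniformity_l2 :: "('a l2 \<times> 'a l2) filter" where
  "uniformity_l2 = (INF e\<in>{0<..}. principal {(x, y). dist x y < e})"

definition open_l2 :: "'a l2 set \<Rightarrow> bool" where
  "open_l2 U \<longleftrightarrow> (\<forall>x\<in>U. \<forall>\<^sub>F (x', y) in uniformity. x' = x \<longrightarrow> y \<in> U)"

instance
proof
  fix x y z :: "'a l2" and r :: real and U :: "'a l2 set"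
  show "dist x y = norm (x - y)" by (simp add: dist_l2_def)
  show "sgn x = x /\<^sub>R norm x" by (simp add: sgn_l2_def)
  show "uniformity = (INF e\<in>{0<..}. principal {(x::'a l2, y). dist x y < e})"
    by (rule uniformity_l2_def)
  show "open U \<longleftrightarrow> (\<forall>x\<in>U. \<forall>\<^sub>F (x', y) in uniformity. x' = x \<longrightarrow> y \<in> U)"
    by (rule open_l2_def)
  show "inner x y = inner y x"
    by (simp add: inner_l2_def cinner_commute[of x y])
  show "inner (x + y) z = inner x z + inner y z"
    by (simp add: inner_l2_def cinner_add_left)
  show "inner (r *\<^sub>R x) y = r * inner x y"
    by (simp add: inner_l2_def cinner_scaleR_left)
  show "0 \<le> inner x x"
    by (simp add: inner_l2_def l2_cinner_self infsum_nonneg)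
  show "norm x = sqrt (inner x x)"
    by (simp add: inner_l2_def l2_cinner_self norm_l2_def)
  show "inner x x = 0 \<longleftrightarrow> x = 0"
  proof
    assume "inner x x = 0"
    then have 0: "(\<Sum>\<^sub>\<infinity>u. (cmod (l2_apply x u))\<^sup>2) = 0"
      by (simp add: inner_l2_def l2_cinner_self)
    have s: "(\<lambda>u. (cmod (l2_apply x u))\<^sup>2) summable_on UNIV"
      using l2_apply[of x] by simp
    have "(cmod (l2_apply x u))\<^sup>2 = 0" for u
      by (rule nonneg_infsum_le_0D[where A = UNIV]) (use 0 s in auto)
    then show "x = 0"
      by (simp add: zero_l2.rep_eq fun_eq_iff flip: l2_apply_inject)
  next
    assume "x = 0"
    then show "inner x x = 0"
      by (simp add: inner_l2_def l2_cinner_self zero_l2.rep_eq)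
  qed
qed

end

lemma norm_l2_square: "(norm f)\<^sup>2 = (\<Sum>\<^sub>\<infinity>x. (cmod (l2_apply f x))\<^sup>2)"
  by (simp add: norm_l2_def infsum_nonneg)

section \<open>Bounded operators\<close>

lift_definition scaleC_l2 :: "complex \<Rightarrow> 'a l2 \<Rightarrow> 'a l2" is "\<lambda>c f x. c * f x"
  by (simp only: mem_Collect_eq l2_summable_scale)

lemma norm_scaleC_l2: "norm (scaleC_l2 c f) = cmod c * norm f"
  by (simp add: norm_l2_def scaleC_l2.rep_eq norm_mult power_mult_distrib infsum_cmult_right'
      real_sqrt_mult)

lift_definition scalar_op :: "complex \<Rightarrow> 'a l2 \<Rightarrow>\<^sub>L 'a l2" is scaleC_l2
proof (rule bounded_linear_intro)
  fix c :: complex and f g :: "'a l2" and r :: real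
  show "scaleC_l2 c (f + g) = scaleC_l2 c f + scaleC_l2 c g"
    by transfer (simp add: fun_eq_iff algebra_simps)
  show "scaleC_l2 c (r *\<^sub>R f) = r *\<^sub>R scaleC_l2 c f"
    by transfer (simp add: fun_eq_iff algebra_simps)
  show "norm (scaleC_l2 c f) \<le> norm f * cmod c"
    by (simp add: norm_scaleC_l2)
qed

text \<open>
  The elements of \<open>'a l2 \<Rightarrow>\<^sub>L 'a l2\<close> are the bounded real-linear operators; \<open>B(l\<^sup>2)\<close> consists of those
  which are complex-linear.  The multiple of an operator \<open>a\<close> by the complex number \<open>c\<close> is
  \<open>scalar_op c o\<^sub>L a\<close>.
\<close>

definition bounded_ops :: "('a l2 \<Rightarrow>\<^sub>L 'a l2) set" where
  "bounded_ops = {a. \<forall>c \<xi>. blinfun_apply a (scaleC_l2 c \<xi>) = scaleC_l2 c (blinfun_apply a \<xi>)}"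

definition is_adjoint :: "('a l2 \<Rightarrow>\<^sub>L 'a l2) \<Rightarrow> ('a l2 \<Rightarrow>\<^sub>L 'a l2) \<Rightarrow> bool" where
  "is_adjoint a b \<longleftrightarrow>
     (\<forall>\<xi> \<eta>. cinner (blinfun_apply a \<xi>) \<eta> = cinner \<xi> (blinfun_apply b \<eta>))"

definition cstar_subalgebra :: "('a l2 \<Rightarrow>\<^sub>L 'a l2) set \<Rightarrow> bool" where
  "cstar_subalgebra A \<longleftrightarrow>
     A \<subseteq> bounded_ops \<and> closed A \<and> 0 \<in> A \<and>
     (\<forall>a\<in>A. \<forall>b\<in>A. a + b \<in> A) \<and>
     (\<forall>c. \<forall>a\<in>A. scalar_op c o\<^sub>L a \<in> A) \<and>
     (\<forall>a\<in>A. \<forall>b\<in>A. a o\<^sub>L b \<in> A) \<and>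
     (\<forall>a\<in>A. \<forall>b\<in>bounded_ops. is_adjoint a b \<longrightarrow> b \<in> A)"

definition cstar_generated :: "('a l2 \<Rightarrow>\<^sub>L 'a l2) set \<Rightarrow> ('a l2 \<Rightarrow>\<^sub>L 'a l2) set" where
  "cstar_generated S = \<Inter>{A. cstar_subalgebra A \<and> S \<subseteq> A}"

section \<open>The reduced group C*-algebra\<close>

lemma l2_translate_bij: "bij (\<lambda>h. - g + h)" for g :: "'g::group_add"
  by (rule bij_betw_byWitness[where f' = "\<lambda>h. g + h"]) (simp_all add: add.assoc[symmetric])

lift_definition translate :: "'g::group_add \<Rightarrow> 'g l2 \<Rightarrow> 'g l2" is "\<lambda>g \<xi> h. \<xi> (- g + h)"
  by (simp add: summable_on_reindex_bij_betw[OF l2_translate_bij, where f = "\<lambda>h. (cmod (_ h))\<^sup>2"])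

lemma norm_translate: "norm (translate g \<xi>) = norm \<xi>"
  by (simp add: norm_l2_def translate.rep_eq
      infsum_reindex_bij_betw[OF l2_translate_bij, where f = "\<lambda>h. (cmod (l2_apply \<xi> h))\<^sup>2"])

lift_definition translation_op :: "'g::group_add \<Rightarrow> 'g l2 \<Rightarrow>\<^sub>L 'g l2" is translate
proof (rule bounded_linear_intro)
  fix g :: 'g and \<xi> \<eta> :: "'g l2" and r :: real
  show "translate g (\<xi> + \<eta>) = translate g \<xi> + translate g \<eta>"
    by transfer simp
  show "translate g (r *\<^sub>R \<xi>) = r *\<^sub>R translate g \<xi>"
    by transfer simp
  show "norm (translate g \<xi>) \<le> norm \<xi> * 1"
    by (simp add: norm_translate)
qed

definition left_regular :: "('g::group_add \<Rightarrow>\<^sub>0 complex) \<Rightarrow> 'g l2 \<Rightarrow>\<^sub>L 'g l2" where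
  "left_regular x =
     (\<Sum>g\<in>Poly_Mapping.keys x. scalar_op (Poly_Mapping.lookup x g) o\<^sub>L translation_op g)"

definition reduced_cstar :: "('g::group_add l2 \<Rightarrow>\<^sub>L 'g l2) set" where
  "reduced_cstar = cstar_generated (range left_regular)"

section \<open>Length functions and rapid decay\<close>

definition length_function :: "('g::group_add \<Rightarrow> real) \<Rightarrow> bool" where
  "length_function l \<longleftrightarrow>
     (\<forall>g. 0 \<le> l g) \<and> l 0 = 0 \<and> (\<forall>g h. l (g + h) \<le> l g + l h) \<and> (\<forall>g. l (- g) = l g)"

definition proper_length :: "('g \<Rightarrow> real) \<Rightarrow> bool" where
  "proper_length l \<longleftrightarrow> (\<forall>c>0. finite (l -` {0..c}))"

definition rapid_decay :: "('g::group_add \<Rightarrow> real) \<Rightarrow> bool" where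
  "rapid_decay l \<longleftrightarrow>
     (\<exists>C>0. \<exists>s>0. \<forall>x :: 'g \<Rightarrow>\<^sub>0 complex.
        norm (left_regular x) \<le>
          C * sqrt (\<Sum>g\<in>Poly_Mapping.keys x.
                      (1 + l g) powr (2 * s) * (cmod (Poly_Mapping.lookup x g))\<^sup>2))"

section \<open>The Dirac operator and iterated commutators\<close>

definition dirac_dom :: "('g \<Rightarrow> real) \<Rightarrow> 'g l2 set" where
  "dirac_dom l = {\<xi>. (\<lambda>g. (cmod (of_real (l g) * l2_apply \<xi> g))\<^sup>2) summable_on UNIV}"

definition dirac :: "('g \<Rightarrow> real) \<Rightarrow> 'g l2 \<Rightarrow> 'g l2" where
  "dirac l \<xi> = Abs_l2 (\<lambda>g. of_real (l g) * l2_apply \<xi> g)"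

definition commutator_bounded :: "('g \<Rightarrow> real) \<Rightarrow> ('g l2 \<Rightarrow>\<^sub>L 'g l2) \<Rightarrow> bool" where
  "commutator_bounded l a \<longleftrightarrow>
     blinfun_apply a ` dirac_dom l \<subseteq> dirac_dom l \<and>
     (\<exists>C. \<forall>\<xi>\<in>dirac_dom l.
        norm (dirac l (blinfun_apply a \<xi>) - blinfun_apply a (dirac l \<xi>)) \<le> C * norm \<xi>)"

text \<open>
  As \<open>dirac_dom l\<close> is dense, at most one bounded operator extends the commutator, and one does
  whenever \<open>commutator_bounded l a\<close> holds; otherwise the value is irrelevant.
\<close>

definition commutator :: "('g \<Rightarrow> real) \<Rightarrow> ('g l2 \<Rightarrow>\<^sub>L 'g l2) \<Rightarrow> 'g l2 \<Rightarrow>\<^sub>L 'g l2" where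
  "commutator l a =
     (THE d. \<forall>\<xi>\<in>dirac_dom l.
        blinfun_apply d \<xi> = dirac l (blinfun_apply a \<xi>) - blinfun_apply a (dirac l \<xi>))"

definition lip_domain :: "('g::group_add \<Rightarrow> real) \<Rightarrow> nat \<Rightarrow> ('g l2 \<Rightarrow>\<^sub>L 'g l2) set" where
  "lip_domain l k = {a \<in> reduced_cstar. \<forall>j<k. commutator_bounded l ((commutator l ^^ j) a)}"

definition lip :: "('g \<Rightarrow> real) \<Rightarrow> nat \<Rightarrow> ('g l2 \<Rightarrow>\<^sub>L 'g l2) \<Rightarrow> real" where
  "lip l k a = norm ((commutator l ^^ k) a)"

definition lip_ball :: "('g::group_add \<Rightarrow> real) \<Rightarrow> nat \<Rightarrow> ('g l2 \<Rightarrow>\<^sub>L 'g l2) set" where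
  "lip_ball l k = {a \<in> lip_domain l k. lip l k a \<le> 1}"

definition lip_lower_semicontinuous :: "('g::group_add \<Rightarrow> real) \<Rightarrow> nat \<Rightarrow> bool" where
  "lip_lower_semicontinuous l k \<longleftrightarrow> closedin (top_of_set reduced_cstar) (lip_ball l k)"

section \<open>The state space\<close>

text \<open>
  Functionals on \<open>A\<close> are represented by their extension with value \<^const>\<open>undefined\<close> outside \<open>A\<close>, so
  that they are equal iff they agree on \<open>A\<close>.  States are the positive linear functionals of norm 1.
\<close>

definition state_space :: "('a l2 \<Rightarrow>\<^sub>L 'a l2) set \<Rightarrow> (('a l2 \<Rightarrow>\<^sub>L 'a l2) \<Rightarrow> complex) set" where
  "state_space A = {\<phi> \<in> extensional A.
     (\<forall>a\<in>A. \<forall>b\<in>A. \<phi> (a + b) = \<phi> a + \<phi> b) \<and>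
     (\<forall>c. \<forall>a\<in>A. \<phi> (scalar_op c o\<^sub>L a) = c * \<phi> a) \<and>
     (\<forall>a\<in>A. \<forall>b\<in>A. is_adjoint a b \<longrightarrow> \<phi> (b o\<^sub>L a) \<in> \<real>\<^sub>\<ge>\<^sub>0) \<and>
     (SUP a\<in>{a \<in> A. norm a \<le> 1}. ennreal (cmod (\<phi> a))) = 1}"

text \<open>On extensional functionals the product topology is the topology of pointwise convergence on \<open>A\<close>.\<close>

definition weak_star_topology ::
    "('a l2 \<Rightarrow>\<^sub>L 'a l2) set \<Rightarrow> (('a l2 \<Rightarrow>\<^sub>L 'a l2) \<Rightarrow> complex) topology" where
  "weak_star_topology A = subtopology (product_topology (\<lambda>_. euclidean) A) (state_space A)"

definition lip_dist :: "('g::group_add \<Rightarrow> real) \<Rightarrow> nat \<Rightarrow>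
    (('g l2 \<Rightarrow>\<^sub>L 'g l2) \<Rightarrow> complex) \<Rightarrow> (('g l2 \<Rightarrow>\<^sub>L 'g l2) \<Rightarrow> complex) \<Rightarrow> ennreal" where
  "lip_dist l k \<phi> \<psi> = (SUP a\<in>lip_ball l k. ennreal (cmod (\<phi> a - \<psi> a)))"

end

theory Submission
  imports Defs
begin

text \<open>
  Let \<open>a \<in> C\<^sup>*\<^sub>r(G)\<close> have Fourier coefficients \<open>x(g) = \<langle>a \<delta>\<^sub>e, \<delta>\<^sub>g\<rangle>\<close>.  Since \<open>\<delta>\<^sup>k(a) \<delta>\<^sub>e\<close> has coordinates
  \<open>l(g)\<^sup>k x(g)\<close>, the bound \<open>L\<^sup>k(a) \<le> 1\<close> forces \<open>\<Sum>\<^sub>g l(g)\<^sup>2\<^sup>k |x(g)|\<^sup>2 \<le> 1\<close>.  For \<open>k \<ge> s + 1\<close> rapid decay then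
  shows that truncating \<open>x\<close> to the finite ball \<open>l \<le> n\<close> changes \<open>a\<close> by at most \<open>2\<^sup>s C / (n + 1)\<close>,
  uniformly over the Lip ball.  States agree on the identity, so two states are close on the Lip
  ball as soon as they are close at finitely many group elements; this gives boundedness and
  one half of the comparison of topologies.  The other half holds because a multiple of each
  \<open>\<lambda>\<^sub>g\<close> lies in the Lip ball and \<open>\<lambda>(\<complex>G)\<close> is dense.

  For lower semicontinuity, \<open>\<delta>\<^sup>j(a)\<close> has matrix entries \<open>(l(g) - l(h))\<^sup>j a\<^sub>g\<^sub>h\<close>, and uniform bounds on
  finite sections of matrices survive entrywise limits.  Uniform bounds on the intermediate
  \<open>\<delta>\<^sup>j(a)\<close> come from those on \<open>a\<close> and \<open>\<delta>\<^sup>k(a)\<close> by Landau's inequality.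
\<close>

section \<open>Operators and their matrices\<close>

lemma l2_eqI: "(\<And>g. l2_apply \<xi> g = l2_apply \<eta> g) \<Longrightarrow> \<xi> = \<eta>"
  by (simp add: fun_eq_iff flip: l2_apply_inject)

lemma l2_apply_sum: "l2_apply (sum f A) g = (\<Sum>h\<in>A. l2_apply (f h) g)"
  by (induction A rule: infinite_finite_induct) (simp_all add: zero_l2.rep_eq plus_l2.rep_eq)

lemma L2_set_le_norm_l2:
  assumes "finite F"
  shows "L2_set (\<lambda>g. cmod (l2_apply \<xi> g)) F \<le> norm \<xi>"
  unfolding L2_set_def norm_l2_def using l2_apply[of \<xi>] assms
  by (intro real_sqrt_le_mono finite_sum_le_infsum) auto

lemma norm_l2_apply_le: "cmod (l2_apply \<xi> g) \<le> norm \<xi>"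
  using L2_set_le_norm_l2[of "{g}" \<xi>] by simp

lemma tendsto_l2_apply:
  assumes "(f \<longlongrightarrow> \<xi>) F"
  shows "((\<lambda>x. l2_apply (f x) g) \<longlongrightarrow> l2_apply \<xi> g) F"
proof (rule Lim_null_comparison[THEN LIM_zero_cancel])
  show "\<forall>\<^sub>F x in F. norm (l2_apply (f x) g - l2_apply \<xi> g) \<le> norm (f x - \<xi>)"
    by (intro always_eventually allI) (metis minus_l2.rep_eq norm_l2_apply_le)
  show "((\<lambda>x. norm (f x - \<xi>)) \<longlongrightarrow> 0) F"
    using assms by (simp add: LIM_zero_iff tendsto_norm_zero)
qed

lemma l2_summableI:
  assumes "\<And>F. finite F \<Longrightarrow> L2_set (\<lambda>g. cmod (f g)) F \<le> M"
  shows "(\<lambda>g. (cmod (f g))\<^sup>2) summable_on UNIV"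
proof (rule nonneg_bdd_above_summable_on)
  have "(\<Sum>g\<in>F. (cmod (f g))\<^sup>2) \<le> M\<^sup>2" if "finite F" for F
  proof -
    have "(L2_set (\<lambda>g. cmod (f g)) F)\<^sup>2 \<le> M\<^sup>2"
      using assms[OF that] by (intro power_mono) auto
    then show ?thesis by (simp add: L2_set_def sum_nonneg)
  qed
  then show "bdd_above (sum (\<lambda>g. (cmod (f g))\<^sup>2) ` {F. F \<subseteq> UNIV \<and> finite F})"
    by (intro bdd_aboveI2[where M = "M\<^sup>2"]) auto
qed auto

lemma norm_l2_leI:
  assumes "\<And>F. finite F \<Longrightarrow> L2_set (\<lambda>g. cmod (l2_apply \<xi> g)) F \<le> M"
  shows "norm \<xi> \<le> M"
proof -
  have M: "0 \<le> M" using assms[of "{}"] by simp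
  have "(\<Sum>g\<in>F. (cmod (l2_apply \<xi> g))\<^sup>2) \<le> M\<^sup>2" if "finite F" for F
    using power_mono[OF assms[OF that] L2_set_nonneg, of 2] by (simp add: L2_set_def sum_nonneg)
  then have "(\<Sum>\<^sub>\<infinity>g. (cmod (l2_apply \<xi> g))\<^sup>2) \<le> M\<^sup>2"
    using l2_apply[of \<xi>] by (intro infsum_le_finite_sums) auto
  then show ?thesis
    using M by (simp add: norm_l2_def real_le_lsqrt infsum_nonneg)
qed

section \<open>Finitely supported vectors and their density\<close>

lift_definition unit_l2 :: "'a \<Rightarrow> 'a l2" is "\<lambda>h g. of_bool (g = h)"
  by (auto intro!: finite_nonzero_values_imp_summable_on)

definition fin_l2 :: "'a set \<Rightarrow> ('a \<Rightarrow> complex) \<Rightarrow> 'a l2" where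
  "fin_l2 F f = (\<Sum>h\<in>F. scaleC_l2 (f h) (unit_l2 h))"

lemma l2_apply_fin:
  "finite F \<Longrightarrow> l2_apply (fin_l2 F f) g = (if g \<in> F then f g else 0)"
  by (simp add: fin_l2_def l2_apply_sum scaleC_l2.rep_eq unit_l2.rep_eq of_bool_def if_distrib
      cong: if_cong)

lemma norm_fin_l2:
  assumes "finite F"
  shows "norm (fin_l2 F f) = L2_set (\<lambda>g. cmod (f g)) F"
proof -
  have "(\<Sum>\<^sub>\<infinity>g. (cmod (l2_apply (fin_l2 F f) g))\<^sup>2) = (\<Sum>\<^sub>\<infinity>g\<in>F. (cmod (f g))\<^sup>2)"
    by (rule infsum_cong_neutral) (auto simp: l2_apply_fin assms)
  then show ?thesis using assms by (simp add: norm_l2_def L2_set_def)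
qed

lemma unit_l2_eq_fin_l2: "unit_l2 h = fin_l2 {h} (\<lambda>_. 1)"
  by (rule l2_eqI) (simp add: l2_apply_fin unit_l2.rep_eq)

lemma norm_unit_l2 [simp]: "norm (unit_l2 h) = 1"
  by (simp add: unit_l2_eq_fin_l2 norm_fin_l2)

text \<open>The squared error of a truncation is the tail of a convergent sum of squares. The limit
  runs along the net of finite subsets, since the index type comes with no enumeration.\<close>

lemma tendsto_fin_l2:
  "((\<lambda>F. fin_l2 F (l2_apply \<xi>)) \<longlongrightarrow> \<xi>) (finite_subsets_at_top UNIV)"
proof -
  let ?n = "\<lambda>g. (cmod (l2_apply \<xi> g))\<^sup>2"
  have s: "?n summable_on UNIV" using l2_apply[of \<xi>] by simp
  have eq: "norm (fin_l2 F (l2_apply \<xi>) - \<xi>) = sqrt ((norm \<xi>)\<^sup>2 - sum ?n F)" if "finite F" for F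
  proof -
    have "(norm (fin_l2 F (l2_apply \<xi>) - \<xi>))\<^sup>2 = (\<Sum>\<^sub>\<infinity>g\<in>UNIV-F. ?n g)"
      unfolding norm_l2_square
      by (rule infsum_cong_neutral) (auto simp: l2_apply_fin minus_l2.rep_eq that)
    also have "\<dots> = (norm \<xi>)\<^sup>2 - sum ?n F"
      using s that by (subst infsum_Diff) (auto simp: norm_l2_square)
    finally show ?thesis by (rule real_sqrt_unique[symmetric]) simp
  qed
  have "(sum ?n \<longlongrightarrow> (norm \<xi>)\<^sup>2) (finite_subsets_at_top UNIV)"
    using has_sum_infsum[OF s] by (simp add: has_sum_def norm_l2_square)
  then have "((\<lambda>F. sqrt ((norm \<xi>)\<^sup>2 - sum ?n F)) \<longlongrightarrow> sqrt ((norm \<xi>)\<^sup>2 - (norm \<xi>)\<^sup>2))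
      (finite_subsets_at_top UNIV)"
    by (intro tendsto_intros)
  moreover have "\<forall>\<^sub>F F in finite_subsets_at_top UNIV.
      sqrt ((norm \<xi>)\<^sup>2 - sum ?n F) = norm (fin_l2 F (l2_apply \<xi>) - \<xi>)"
    by (rule eventually_finite_subsets_at_top_weakI) (simp add: eq)
  ultimately have "((\<lambda>F. norm (fin_l2 F (l2_apply \<xi>) - \<xi>)) \<longlongrightarrow> 0) (finite_subsets_at_top UNIV)"
    by (simp add: tendsto_cong)
  then show ?thesis
    by (simp add: tendsto_norm_zero_iff LIM_zero_cancel)
qed

section \<open>Matrix entries with respect to the standard basis\<close>

definition entry :: "('a l2 \<Rightarrow>\<^sub>L 'a l2) \<Rightarrow> 'a \<Rightarrow> 'a \<Rightarrow> complex" where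
  "entry a g h = l2_apply (blinfun_apply a (unit_l2 h)) g"

lemma entry_add: "entry (a + b) g h = entry a g h + entry b g h"
  by (simp add: entry_def blinfun.add_left plus_l2.rep_eq)

lemma entry_diff: "entry (a - b) g h = entry a g h - entry b g h"
  by (simp add: entry_def blinfun.diff_left minus_l2.rep_eq)

lemma entry_scalar_op: "entry (scalar_op c o\<^sub>L a) g h = c * entry a g h"
  by (simp add: entry_def scalar_op.rep_eq scaleC_l2.rep_eq)

lemma tendsto_entry: "(f \<longlongrightarrow> a) F \<Longrightarrow> ((\<lambda>x. entry (f x) g h) \<longlongrightarrow> entry a g h) F"
  unfolding entry_def by (intro tendsto_l2_apply tendsto_intros)

lemma apply_fin_l2:
  assumes "a \<in> bounded_ops"
  shows "l2_apply (blinfun_apply a (fin_l2 F f)) g = (\<Sum>h\<in>F. entry a g h * f h)"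
  using assms
  by (simp add: fin_l2_def blinfun.sum_right l2_apply_sum bounded_ops_def scaleC_l2.rep_eq
      entry_def mult.commute)

lemma blinfun_eqI_fin:
  assumes "\<And>F f. finite F \<Longrightarrow> blinfun_apply a (fin_l2 F f) = blinfun_apply b (fin_l2 F f)"
  shows "a = b"
proof (rule blinfun_eqI)
  fix \<xi>
  let ?fa = "finite_subsets_at_top UNIV"
  have a: "((\<lambda>F. blinfun_apply a (fin_l2 F (l2_apply \<xi>))) \<longlongrightarrow> blinfun_apply a \<xi>) ?fa"
    by (intro tendsto_intros tendsto_fin_l2)
  have "((\<lambda>F. blinfun_apply b (fin_l2 F (l2_apply \<xi>))) \<longlongrightarrow> blinfun_apply b \<xi>) ?fa"
    by (intro tendsto_intros tendsto_fin_l2)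
  moreover have "\<forall>\<^sub>F F in ?fa. blinfun_apply a (fin_l2 F (l2_apply \<xi>))
      = blinfun_apply b (fin_l2 F (l2_apply \<xi>))"
    using assms by (intro eventually_finite_subsets_at_top_weakI)
  ultimately have "((\<lambda>F. blinfun_apply a (fin_l2 F (l2_apply \<xi>))) \<longlongrightarrow> blinfun_apply b \<xi>) ?fa"
    by (simp add: tendsto_cong)
  with a show "blinfun_apply a \<xi> = blinfun_apply b \<xi>"
    by (rule tendsto_unique[OF finite_subsets_at_top_neq_bot])
qed

lemma bounded_ops_eqI:
  assumes "a \<in> bounded_ops" "b \<in> bounded_ops" "\<And>g h. entry a g h = entry b g h"
  shows "a = b"
  using assms by (intro blinfun_eqI_fin l2_eqI) (simp add: apply_fin_l2)

section \<open>Uniform bounds on finite sections of matrices\<close>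

text \<open>This is the operator norm bound in weak form, as a sesquilinear form on finite square
  sections. It speaks of a bare matrix, so it can be established for entrywise limits and weighted
  matrices before any operator with these entries is known to exist.\<close>

definition matrix_bound :: "real \<Rightarrow> ('a \<Rightarrow> 'a \<Rightarrow> complex) \<Rightarrow> bool" where
  "matrix_bound M m \<longleftrightarrow> (\<forall>F \<xi> \<eta>. finite F \<longrightarrow>
     cmod (\<Sum>g\<in>F. \<Sum>h\<in>F. m g h * \<xi> h * cnj (\<eta> g)) \<le>
       M * L2_set (\<lambda>h. cmod (\<xi> h)) F * L2_set (\<lambda>g. cmod (\<eta> g)) F)"

lemma matrix_boundD:
  assumes "matrix_bound M m" "finite F"
  shows "cmod (\<Sum>g\<in>F. \<Sum>h\<in>F. m g h * \<xi> h * cnj (\<eta> g)) \<le>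
    M * L2_set (\<lambda>h. cmod (\<xi> h)) F * L2_set (\<lambda>g. cmod (\<eta> g)) F"
  using assms unfolding matrix_bound_def by blast

lemma matrix_bound_mono: "matrix_bound M m \<Longrightarrow> M \<le> N \<Longrightarrow> matrix_bound N m"
  unfolding matrix_bound_def
  by (meson L2_set_nonneg mult_right_mono order_trans)

lemma matrix_boundI_L2:
  assumes "\<And>F \<xi>. finite F \<Longrightarrow>
    L2_set (\<lambda>g. cmod (\<Sum>h\<in>F. m g h * \<xi> h)) F \<le> M * L2_set (\<lambda>h. cmod (\<xi> h)) F"
  shows "matrix_bound M m"
  unfolding matrix_bound_def
proof (intro allI impI)
  fix F :: "'a set" and \<xi> \<eta> :: "'a \<Rightarrow> complex"
  assume F: "finite F"
  have "cmod (\<Sum>g\<in>F. \<Sum>h\<in>F. m g h * \<xi> h * cnj (\<eta> g)) =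
      cmod (\<Sum>g\<in>F. (\<Sum>h\<in>F. m g h * \<xi> h) * cnj (\<eta> g))"
    by (simp add: sum_distrib_right)
  also have "\<dots> \<le> (\<Sum>g\<in>F. \<bar>cmod (\<Sum>h\<in>F. m g h * \<xi> h)\<bar> * \<bar>cmod (\<eta> g)\<bar>)"
    by (rule order_trans[OF norm_sum]) (simp add: norm_mult)
  also have "\<dots> \<le> L2_set (\<lambda>g. cmod (\<Sum>h\<in>F. m g h * \<xi> h)) F * L2_set (\<lambda>g. cmod (\<eta> g)) F"
    by (rule L2_set_mult_ineq)
  also have "\<dots> \<le> M * L2_set (\<lambda>h. cmod (\<xi> h)) F * L2_set (\<lambda>g. cmod (\<eta> g)) F"
    by (intro mult_right_mono assms F) simp
  finally show "cmod (\<Sum>g\<in>F. \<Sum>h\<in>F. m g h * \<xi> h * cnj (\<eta> g)) \<le>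
       M * L2_set (\<lambda>h. cmod (\<xi> h)) F * L2_set (\<lambda>g. cmod (\<eta> g)) F" .
qed

lemma matrix_boundD_L2:
  assumes "matrix_bound M m" "0 \<le> M" "finite F"
  shows "L2_set (\<lambda>g. cmod (\<Sum>h\<in>F. m g h * \<xi> h)) F \<le> M * L2_set (\<lambda>h. cmod (\<xi> h)) F"
proof -
  \<comment> \<open>Duality: testing the form against the image vector itself turns it into the
    square of the norm of that vector, and one factor then cancels.\<close>
  define \<eta> where "\<eta> g = (\<Sum>h\<in>F. m g h * \<xi> h)" for g
  let ?e = "L2_set (\<lambda>g. cmod (\<eta> g)) F"
  have "(\<Sum>g\<in>F. \<Sum>h\<in>F. m g h * \<xi> h * cnj (\<eta> g)) = (\<Sum>g\<in>F. of_real ((cmod (\<eta> g))\<^sup>2))"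
    by (intro sum.cong refl, subst complex_norm_square) (simp add: \<eta>_def sum_distrib_right)
  also have "\<dots> = of_real (\<Sum>g\<in>F. (cmod (\<eta> g))\<^sup>2)" by simp
  also have "cmod \<dots> = ?e * ?e"
    by (simp add: L2_set_def sum_nonneg del: of_real_sum of_real_power)
  finally have "?e * ?e \<le> M * L2_set (\<lambda>h. cmod (\<xi> h)) F * ?e"
    using matrix_boundD[OF assms(1,3), of \<xi> \<eta>] by simp
  then show ?thesis
    unfolding \<eta>_def[symmetric]
    by (metis L2_set_nonneg assms(2) mult_nonneg_nonneg mult_right_le_imp_le order_le_less)
qed

lemma matrix_bound_norm:
  assumes "a \<in> bounded_ops"
  shows "matrix_bound (norm a) (entry a)"
proof (rule matrix_boundI_L2)
  fix F :: "'a set" and \<xi>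
  assume F: "finite F"
  show "L2_set (\<lambda>g. cmod (\<Sum>h\<in>F. entry a g h * \<xi> h)) F \<le> norm a * L2_set (\<lambda>h. cmod (\<xi> h)) F"
    using L2_set_le_norm_l2[OF F, of "blinfun_apply a (fin_l2 F \<xi>)"]
      norm_blinfun[of a "fin_l2 F \<xi>"]
    by (simp add: apply_fin_l2[OF assms] norm_fin_l2[OF F])
qed

text \<open>This is the converse of \<open>matrix_bound_norm\<close>. The bound makes each row
  square summable, so the matrix acts on all of \<open>l2\<close> by convergent series, and the norm
  estimate passes from finite sections to the limit.\<close>

lemma matrix_bound_operator:
  fixes m :: "'a \<Rightarrow> 'a \<Rightarrow> complex"
  assumes m: "matrix_bound M m" and M: "0 \<le> M"
  obtains d where "d \<in> bounded_ops" "norm d \<le> M" "\<And>g h. entry d g h = m g h"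
proof -
  \<comment> \<open>The conjugate of row \<open>g\<close> is used as test vector on a section that
    contains \<open>g\<close>. Coordinate \<open>g\<close> of its image is the squared norm of the
    row, which is therefore at most \<open>M\<close> times that norm.\<close>
  have row: "(\<lambda>h. (cmod (cnj (m g h)))\<^sup>2) summable_on UNIV" for g
  proof (rule l2_summableI)
    fix F :: "'a set"
    assume F: "finite F"
    let ?F = "insert g F" let ?r = "L2_set (\<lambda>h. cmod (m g h)) ?F"
    have "?r * ?r = cmod (of_real (\<Sum>h\<in>?F. (cmod (m g h))\<^sup>2))"
      by (simp add: L2_set_def sum_nonneg F del: of_real_sum of_real_power sum.insert)
    also have "of_real (\<Sum>h\<in>?F. (cmod (m g h))\<^sup>2) = (\<Sum>h\<in>?F. m g h * cnj (m g h))"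
      by (simp only: of_real_sum complex_norm_square)
    also have "cmod \<dots> \<le> L2_set (\<lambda>g'. cmod (\<Sum>h\<in>?F. m g' h * cnj (m g h))) ?F"
      using F by (intro member_le_L2_set[of _ g "\<lambda>g'. cmod (\<Sum>h\<in>?F. m g' h * cnj (m g h))"]) auto
    also have "\<dots> \<le> M * ?r"
      using matrix_boundD_L2[OF m M, of ?F "\<lambda>h. cnj (m g h)"] F by simp
    finally have "?r \<le> M"
      by (metis L2_set_nonneg M mult_right_le_imp_le order_le_less)
    moreover have "L2_set (\<lambda>h. cmod (m g h)) F \<le> ?r"
      unfolding L2_set_def using F by (intro real_sqrt_le_mono sum_mono2) auto
    ultimately show "L2_set (\<lambda>h. cmod (cnj (m g h))) F \<le> M" by simp
  qed
  define r where "r \<xi> g = (\<Sum>\<^sub>\<infinity>h. m g h * l2_apply \<xi> h)" for \<xi> g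
  have s: "(\<lambda>h. m g h * l2_apply \<xi> h) summable_on UNIV" for g \<xi>
    using l2_summable_mult[OF _ row, of "l2_apply \<xi>" g] l2_apply[of \<xi>] by (simp add: mult.commute)
  \<comment> \<open>The set \<open>F\<close> of output coordinates stays fixed while the set
    \<open>H\<close> of input coordinates grows. Once \<open>F \<subseteq> H\<close>, the square
    section on \<open>H\<close> dominates.\<close>
  have r: "L2_set (\<lambda>g. cmod (r \<xi> g)) F \<le> M * norm \<xi>" if F: "finite F" for F \<xi>
  proof (rule tendsto_upperbound)
    show "((\<lambda>H. L2_set (\<lambda>g. cmod (\<Sum>h\<in>H. m g h * l2_apply \<xi> h)) F) \<longlongrightarrow>
        L2_set (\<lambda>g. cmod (r \<xi> g)) F) (finite_subsets_at_top UNIV)"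
      unfolding L2_set_def r_def
      by (intro tendsto_intros) (use has_sum_infsum[OF s] in \<open>simp add: has_sum_def\<close>)
    have "L2_set (\<lambda>g. cmod (\<Sum>h\<in>H. m g h * l2_apply \<xi> h)) F \<le> M * norm \<xi>"
      if H: "finite H" "F \<subseteq> H" for H
    proof -
      have "L2_set (\<lambda>g. cmod (\<Sum>h\<in>H. m g h * l2_apply \<xi> h)) F
          \<le> L2_set (\<lambda>g. cmod (\<Sum>h\<in>H. m g h * l2_apply \<xi> h)) H"
        unfolding L2_set_def using H by (intro real_sqrt_le_mono sum_mono2) auto
      also have "\<dots> \<le> M * L2_set (\<lambda>h. cmod (l2_apply \<xi> h)) H"
        by (rule matrix_boundD_L2[OF m M H(1)])
      also have "\<dots> \<le> M * norm \<xi>"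
        by (intro mult_left_mono L2_set_le_norm_l2 M H)
      finally show ?thesis .
    qed
    then show "\<forall>\<^sub>F H in finite_subsets_at_top UNIV.
        L2_set (\<lambda>g. cmod (\<Sum>h\<in>H. m g h * l2_apply \<xi> h)) F \<le> M * norm \<xi>"
      using F by (auto simp: eventually_finite_subsets_at_top)
  qed simp
  have ap: "l2_apply (Abs_l2 (r \<xi>)) = r \<xi>" for \<xi>
    using l2_summableI[OF r] by (intro Abs_l2_inverse) simp
  have bound: "norm (Abs_l2 (r \<xi>)) \<le> norm \<xi> * M" for \<xi>
    using r by (intro norm_l2_leI) (simp add: ap mult.commute)
  have lin: "bounded_linear (\<lambda>\<xi>. Abs_l2 (r \<xi>))"
  proof (rule bounded_linear_intro[OF _ _ bound])
    show "Abs_l2 (r (\<xi> + \<eta>)) = Abs_l2 (r \<xi>) + Abs_l2 (r \<eta>)" for \<xi> \<eta>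
      by (rule l2_eqI) (simp add: ap plus_l2.rep_eq, simp add: r_def plus_l2.rep_eq distrib_left
          infsum_add s)
    show "Abs_l2 (r (c *\<^sub>R \<xi>)) = c *\<^sub>R Abs_l2 (r \<xi>)" for c \<xi>
      by (rule l2_eqI) (simp add: ap scaleR_l2.rep_eq, simp add: r_def scaleR_l2.rep_eq
          mult.left_commute infsum_cmult_right')
  qed
  show ?thesis
  proof
    show "Blinfun (\<lambda>\<xi>. Abs_l2 (r \<xi>)) \<in> bounded_ops"
      unfolding bounded_ops_def
      by (simp add: bounded_linear_Blinfun_apply[OF lin])
        (intro allI l2_eqI, simp add: ap scaleC_l2.rep_eq, simp add: r_def scaleC_l2.rep_eq
          mult.left_commute infsum_cmult_right')
    show "norm (Blinfun (\<lambda>\<xi>. Abs_l2 (r \<xi>))) \<le> M"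
      using bound M by (intro norm_blinfun_bound)
        (simp_all add: bounded_linear_Blinfun_apply[OF lin] mult.commute)
    fix g h
    have "r (unit_l2 h) g = (\<Sum>\<^sub>\<infinity>h'\<in>{h}. m g h)"
      unfolding r_def by (rule infsum_cong_neutral) (auto simp: unit_l2.rep_eq)
    then show "entry (Blinfun (\<lambda>\<xi>. Abs_l2 (r \<xi>))) g h = m g h"
      by (simp add: entry_def bounded_linear_Blinfun_apply[OF lin] ap)
  qed
qed

text \<open>A complex-linear bounded operator is determined by its entries, so the operator
  constructed from the matrix of \<open>a\<close> is \<open>a\<close> itself.\<close>

lemma norm_le_matrix_bound:
  assumes "a \<in> bounded_ops" "matrix_bound M (entry a)" "0 \<le> M"
  shows "norm a \<le> M"
proof -
  obtain d where "d \<in> bounded_ops" "norm d \<le> M" "\<And>g h. entry d g h = entry a g h"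
    using matrix_bound_operator[OF assms(2,3)] by blast
  then show ?thesis using bounded_ops_eqI[OF assms(1)] by metis
qed

text \<open>A finite section involves finitely many entries, so its form depends continuously on
  them, and the bound \<open>M\<close> does not depend on \<open>n\<close>.\<close>

lemma matrix_bound_tendsto:
  assumes "\<And>n. matrix_bound M (f n)" "\<And>g h. (\<lambda>n. f n g h) \<longlonglongrightarrow> m g h"
  shows "matrix_bound M m"
  unfolding matrix_bound_def
proof (intro allI impI)
  fix F :: "'a set" and \<xi> \<eta> :: "'a \<Rightarrow> complex"
  assume "finite F"
  have "(\<lambda>n. cmod (\<Sum>g\<in>F. \<Sum>h\<in>F. f n g h * \<xi> h * cnj (\<eta> g))) \<longlonglongrightarrow>
      cmod (\<Sum>g\<in>F. \<Sum>h\<in>F. m g h * \<xi> h * cnj (\<eta> g))"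
    by (intro tendsto_intros assms)
  then show "cmod (\<Sum>g\<in>F. \<Sum>h\<in>F. m g h * \<xi> h * cnj (\<eta> g)) \<le>
      M * L2_set (\<lambda>h. cmod (\<xi> h)) F * L2_set (\<lambda>g. cmod (\<eta> g)) F"
    by (rule LIMSEQ_le_const2) (use matrix_boundD[OF assms(1) \<open>finite F\<close>] in blast)
qed

text \<open>The dominating matrix has nonnegative entries, so testing it on the moduli of
  \<open>\<xi>\<close> and \<open>\<eta>\<close> already bounds the sum of the absolute values of
  all terms.\<close>

lemma matrix_bound_dominated:
  assumes "matrix_bound M n" "\<And>g h. cmod (m g h) \<le> w g h" "\<And>g h. n g h = of_real (w g h)"
  shows "matrix_bound M m"
  unfolding matrix_bound_def
proof (intro allI impI)
  fix F :: "'a set" and \<xi> \<eta> :: "'a \<Rightarrow> complex"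
  assume F: "finite F"
  let ?S = "\<Sum>g\<in>F. \<Sum>h\<in>F. w g h * cmod (\<xi> h) * cmod (\<eta> g)"
  have "cmod (\<Sum>g\<in>F. \<Sum>h\<in>F. m g h * \<xi> h * cnj (\<eta> g)) \<le> ?S"
    by (intro sum_norm_le) (auto simp: norm_mult intro!: mult_right_mono assms)
  also have "\<dots> \<le> cmod (of_real ?S)" by (simp only: norm_of_real abs_ge_self)
  also have "of_real ?S = (\<Sum>g\<in>F. \<Sum>h\<in>F. n g h * of_real (cmod (\<xi> h)) * cnj (of_real (cmod (\<eta> g))))"
    by (simp add: assms(3))
  also have "cmod \<dots> \<le> M * L2_set (\<lambda>h. cmod (\<xi> h)) F * L2_set (\<lambda>g. cmod (\<eta> g)) F"
    using matrix_boundD[OF assms(1) F, of "\<lambda>h. of_real (cmod (\<xi> h))" "\<lambda>h. of_real (cmod (\<eta> h))"]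
    by simp
  finally show "cmod (\<Sum>g\<in>F. \<Sum>h\<in>F. m g h * \<xi> h * cnj (\<eta> g)) \<le>
      M * L2_set (\<lambda>h. cmod (\<xi> h)) F * L2_set (\<lambda>g. cmod (\<eta> g)) F" .
qed

lemma matrix_bound_adjoint:
  assumes "matrix_bound M m"
  shows "matrix_bound M (\<lambda>g h. cnj (m h g))"
  unfolding matrix_bound_def
proof (intro allI impI)
  fix F :: "'a set" and \<xi> \<eta> :: "'a \<Rightarrow> complex"
  assume F: "finite F"
  have "cmod (\<Sum>g\<in>F. \<Sum>h\<in>F. cnj (m h g) * \<xi> h * cnj (\<eta> g)) =
     cmod (cnj (\<Sum>g\<in>F. \<Sum>h\<in>F. cnj (m h g) * \<xi> h * cnj (\<eta> g)))" by (simp only: complex_mod_cnj)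
  also have "cnj (\<Sum>g\<in>F. \<Sum>h\<in>F. cnj (m h g) * \<xi> h * cnj (\<eta> g)) =
      (\<Sum>h\<in>F. \<Sum>g\<in>F. m h g * \<eta> g * cnj (\<xi> h))"
    by (subst sum.swap) (simp add: mult_ac)
  finally show "cmod (\<Sum>g\<in>F. \<Sum>h\<in>F. cnj (m h g) * \<xi> h * cnj (\<eta> g)) \<le>
      M * L2_set (\<lambda>h. cmod (\<xi> h)) F * L2_set (\<lambda>g. cmod (\<eta> g)) F"
    using matrix_boundD[OF assms F, of \<eta> \<xi>] by (simp add: mult_ac)
qed

section \<open>Commutators with the Dirac operator\<close>

lemma l2_apply_dirac:
  "\<xi> \<in> dirac_dom l \<Longrightarrow> l2_apply (dirac l \<xi>) g = of_real (l g) * l2_apply \<xi> g"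
  by (simp add: dirac_def dirac_dom_def Abs_l2_inverse)

lemma dirac_domI:
  assumes "\<And>g. l2_apply \<eta> g = of_real (l g) * l2_apply \<xi> g"
  shows "\<xi> \<in> dirac_dom l" "dirac l \<xi> = \<eta>"
proof -
  show *: "\<xi> \<in> dirac_dom l"
    using l2_apply[of \<eta>] by (simp add: dirac_dom_def assms)
  show "dirac l \<xi> = \<eta>"
    by (rule l2_eqI) (simp add: l2_apply_dirac[OF *] assms)
qed

lemma dirac_fin_l2:
  assumes "finite F"
  shows "fin_l2 F f \<in> dirac_dom l" "dirac l (fin_l2 F f) = fin_l2 F (\<lambda>g. of_real (l g) * f g)"
  using assms
  by (auto intro!: dirac_domI[of "fin_l2 F (\<lambda>g. of_real (l g) * f g)"] simp: l2_apply_fin)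

text \<open>Write \<open>D\<close> for the Dirac operator. The equation \<open>d + a D = D a\<close>
  is checked entrywise on finitely supported vectors and then carried over to the whole domain. Its
  left side is a vector of \<open>l2\<close>, which is why \<open>a\<close> preserves the
  domain.\<close>

lemma commutator_apply:
  assumes a: "a \<in> bounded_ops" and d: "d \<in> bounded_ops"
    and e: "\<And>g h. entry d g h = of_real (l g - l h) * entry a g h"
    and \<xi>: "\<xi> \<in> dirac_dom l"
  shows "blinfun_apply a \<xi> \<in> dirac_dom l"
    and "blinfun_apply d \<xi> = dirac l (blinfun_apply a \<xi>) - blinfun_apply a (dirac l \<xi>)"
proof -
  let ?fa = "finite_subsets_at_top UNIV"
  \<comment> \<open>Although \<open>D\<close> is unbounded, each single coordinate is only
    multiplied by the number \<open>l g\<close>, so limits can be taken coordinatewise. Truncating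
    \<open>\<xi>\<close> and \<open>dirac l \<xi>\<close> to the same \<open>F\<close> is consistent
    because \<open>D\<close> is diagonal.\<close>
  have *: "l2_apply (blinfun_apply d \<xi> + blinfun_apply a (dirac l \<xi>)) g
      = of_real (l g) * l2_apply (blinfun_apply a \<xi>) g" for g
  proof (rule tendsto_unique)
    show "((\<lambda>F. l2_apply (blinfun_apply d (fin_l2 F (l2_apply \<xi>)) +
          blinfun_apply a (fin_l2 F (l2_apply (dirac l \<xi>)))) g) \<longlongrightarrow>
        l2_apply (blinfun_apply d \<xi> + blinfun_apply a (dirac l \<xi>)) g) ?fa"
      by (intro tendsto_l2_apply tendsto_intros tendsto_fin_l2)
    have "l2_apply (blinfun_apply d (fin_l2 F (l2_apply \<xi>)) +
          blinfun_apply a (fin_l2 F (l2_apply (dirac l \<xi>)))) g =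
        of_real (l g) * l2_apply (blinfun_apply a (fin_l2 F (l2_apply \<xi>))) g" for F
      by (simp add: plus_l2.rep_eq apply_fin_l2[OF a] apply_fin_l2[OF d] e l2_apply_dirac[OF \<xi>]
          sum_distrib_left flip: sum.distrib) (simp add: algebra_simps)
    then show "((\<lambda>F. l2_apply (blinfun_apply d (fin_l2 F (l2_apply \<xi>)) +
          blinfun_apply a (fin_l2 F (l2_apply (dirac l \<xi>)))) g) \<longlongrightarrow>
        of_real (l g) * l2_apply (blinfun_apply a \<xi>) g) ?fa"
      by (simp only:) (intro tendsto_l2_apply tendsto_intros tendsto_fin_l2)
  qed simp
  show "blinfun_apply a \<xi> \<in> dirac_dom l"
    using * by (rule dirac_domI)
  show "blinfun_apply d \<xi> = dirac l (blinfun_apply a \<xi>) - blinfun_apply a (dirac l \<xi>)"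
    using dirac_domI(2)[OF *] by simp
qed

lemma commutator_eqI:
  assumes "a \<in> bounded_ops" "d \<in> bounded_ops"
    and "\<And>g h. entry d g h = of_real (l g - l h) * entry a g h"
  shows "commutator_bounded l a" "commutator l a = d"
proof -
  note c = commutator_apply[OF assms]
  show "commutator_bounded l a"
    unfolding commutator_bounded_def
    using c(1) norm_blinfun[of d] by (auto simp flip: c(2))
  show "commutator l a = d"
    unfolding commutator_def
  proof (rule the_equality)
    \<comment> \<open>Finitely supported vectors lie in the domain and are dense, so the description
      by \<open>THE\<close> is unique even among real-linear operators.\<close>
    fix d'
    assume "\<forall>\<xi>\<in>dirac_dom l.
        blinfun_apply d' \<xi> = dirac l (blinfun_apply a \<xi>) - blinfun_apply a (dirac l \<xi>)"
    then show "d' = d"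
      by (intro blinfun_eqI_fin) (simp add: dirac_fin_l2(1) c(2))
  qed (use c(2) in blast)
qed

text \<open>Evaluated on finitely supported vectors, the bound in \<open>commutator_bounded\<close>
  is a bound on the finite sections of the matrix \<open>(l g - l h) a_gh\<close>, from which an
  operator can be built.\<close>

lemma commutator_bounded_operator:
  assumes a: "a \<in> bounded_ops" and b: "commutator_bounded l a"
  obtains d where "d \<in> bounded_ops" "\<And>g h. entry d g h = of_real (l g - l h) * entry a g h"
proof -
  obtain C where dom: "\<And>\<xi>. \<xi> \<in> dirac_dom l \<Longrightarrow> blinfun_apply a \<xi> \<in> dirac_dom l"
    and C: "\<And>\<xi>. \<xi> \<in> dirac_dom l \<Longrightarrow>
      norm (dirac l (blinfun_apply a \<xi>) - blinfun_apply a (dirac l \<xi>)) \<le> C * norm \<xi>"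
    using b unfolding commutator_bounded_def by blast
  \<comment> \<open>The definition of \<open>commutator_bounded\<close> leaves the sign of
    \<open>C\<close> open, hence the maximum with 0.\<close>
  have "matrix_bound (max C 0) (\<lambda>g h. of_real (l g - l h) * entry a g h)"
  proof (rule matrix_boundI_L2)
    fix F \<xi>
    assume F: "finite (F :: 'a set)"
    let ?\<xi> = "fin_l2 F \<xi>"
    let ?d = "dirac l (blinfun_apply a ?\<xi>) - blinfun_apply a (dirac l ?\<xi>)"
    have "(\<Sum>h\<in>F. of_real (l g - l h) * entry a g h * \<xi> h) = l2_apply ?d g" for g
      by (simp add: minus_l2.rep_eq l2_apply_dirac dom dirac_fin_l2 F apply_fin_l2[OF a]
          sum_distrib_left algebra_simps flip: sum_subtractf)
    then have "L2_set (\<lambda>g. cmod (\<Sum>h\<in>F. of_real (l g - l h) * entry a g h * \<xi> h)) F \<le> norm ?d"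
      by (simp only: L2_set_le_norm_l2[OF F])
    also have "\<dots> \<le> C * norm ?\<xi>"
      by (intro C dirac_fin_l2 F)
    also have "\<dots> \<le> max C 0 * norm ?\<xi>"
      by (intro mult_right_mono) auto
    finally show "L2_set (\<lambda>g. cmod (\<Sum>h\<in>F. of_real (l g - l h) * entry a g h * \<xi> h)) F
        \<le> max C 0 * L2_set (\<lambda>h. cmod (\<xi> h)) F"
      by (simp add: norm_fin_l2 F)
  qed
  from matrix_bound_operator[OF this] show ?thesis using that by (metis max.cobounded2)
qed

lemma iterated_commutator:
  assumes "a \<in> bounded_ops" "\<And>i. i < j \<Longrightarrow> commutator_bounded l ((commutator l ^^ i) a)"
  shows "(commutator l ^^ j) a \<in> bounded_ops"
    and "entry ((commutator l ^^ j) a) g h = of_real (l g - l h) ^ j * entry a g h"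
proof -
  have "(commutator l ^^ j) a \<in> bounded_ops \<and>
      (\<forall>g h. entry ((commutator l ^^ j) a) g h = of_real (l g - l h) ^ j * entry a g h)"
    using assms(2)
  proof (induction j)
    case (Suc j)
    let ?b = "(commutator l ^^ j) a"
    have b: "?b \<in> bounded_ops"
        "\<And>g h. entry ?b g h = of_real (l g - l h) ^ j * entry a g h"
      using Suc by auto
    obtain d where d: "d \<in> bounded_ops" "\<And>g h. entry d g h = of_real (l g - l h) * entry ?b g h"
      using commutator_bounded_operator[OF b(1)] Suc.prems by blast
    then have "commutator l ?b = d"
      by (rule commutator_eqI(2)[OF b(1)])
    with d show ?case by (simp add: b(2))
  qed (use assms in simp)
  then show "(commutator l ^^ j) a \<in> bounded_ops"
    and "entry ((commutator l ^^ j) a) g h = of_real (l g - l h) ^ j * entry a g h" by blast+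
qed

text \<open>This is the criterion for membership in the domain of the seminorm. The induction is
  strong because the entries at stage \<open>j\<close> are known only after all earlier commutators
  have been shown to be bounded; the bound for exponent \<open>j + 1\<close> then supplies the next
  commutator.\<close>

lemma iterated_commutator_bounded:
  assumes a: "a \<in> bounded_ops"
    and M: "\<And>i. i \<le> k \<Longrightarrow> 0 \<le> M i"
      "\<And>i. i \<le> k \<Longrightarrow> matrix_bound (M i) (\<lambda>g h. of_real (l g - l h) ^ i * entry a g h)"
    and "j < k"
  shows "commutator_bounded l ((commutator l ^^ j) a)"
  using \<open>j < k\<close>
proof (induction j rule: less_induct)
  case (less j)
  have lt: "commutator_bounded l ((commutator l ^^ i) a)" if "i < j" for i
    using less.IH[OF that] less.prems that by simp
  have c: "(commutator l ^^ j) a \<in> bounded_ops"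
    "entry ((commutator l ^^ j) a) g h = of_real (l g - l h) ^ j * entry a g h" for g h
    by (rule iterated_commutator[OF a]; erule lt)+
  have sj: "Suc j \<le> k" using less.prems by simp
  obtain d where d: "d \<in> bounded_ops"
    "\<And>g h. entry d g h = of_real (l g - l h) ^ Suc j * entry a g h"
    by (rule matrix_bound_operator[OF M(2)[OF sj] M(1)[OF sj]], rule that)
  show ?case
    by (rule commutator_eqI(1)[OF c(1) d(1)]) (simp_all add: c(2) d(2))
qed

section \<open>Landau's inequality and bounds for the intermediate commutators\<close>

lemma matrix_bound_cmult:
  assumes "matrix_bound M m"
  shows "matrix_bound (cmod c * M) (\<lambda>g h. c * m g h)"
  unfolding matrix_bound_def
proof (intro allI impI)
  fix F :: "'a set" and \<xi> \<eta> :: "'a \<Rightarrow> complex"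
  assume F: "finite F"
  have "(\<Sum>g\<in>F. \<Sum>h\<in>F. c * m g h * \<xi> h * cnj (\<eta> g)) =
      c * (\<Sum>g\<in>F. \<Sum>h\<in>F. m g h * \<xi> h * cnj (\<eta> g))"
    by (simp add: sum_distrib_left mult.assoc)
  then show "cmod (\<Sum>g\<in>F. \<Sum>h\<in>F. c * m g h * \<xi> h * cnj (\<eta> g)) \<le>
      cmod c * M * L2_set (\<lambda>h. cmod (\<xi> h)) F * L2_set (\<lambda>g. cmod (\<eta> g)) F"
    using mult_left_mono[OF matrix_boundD[OF assms F], of "cmod c" \<xi> \<eta>]
    by (simp add: norm_mult mult.assoc)
qed

text \<open>The phases split as \<open>U h * cnj (U g)\<close> and are absorbed into the test
  vectors, whose moduli do not change. This is conjugation by the diagonal unitary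
  \<open>exp (iuD)\<close>.\<close>

lemma matrix_bound_conjugate:
  assumes "matrix_bound M m"
  shows "matrix_bound M (\<lambda>g h. exp (\<i> * of_real (u * (l g - l h))) * m g h)"
  unfolding matrix_bound_def
proof (intro allI impI)
  fix F :: "'a set" and \<xi> \<eta> :: "'a \<Rightarrow> complex"
  assume F: "finite F"
  define U where "U g = exp (- (\<i> * of_real (u * l g)))" for g
  have U: "exp (\<i> * of_real (u * (l g - l h))) = U h * cnj (U g)" for g h
    by (simp add: U_def exp_cnj algebra_simps flip: exp_add)
  have n: "cmod (U g) = 1" for g
    by (simp add: U_def)
  show "cmod (\<Sum>g\<in>F. \<Sum>h\<in>F. exp (\<i> * of_real (u * (l g - l h))) * m g h * \<xi> h * cnj (\<eta> g)) \<le>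
      M * L2_set (\<lambda>h. cmod (\<xi> h)) F * L2_set (\<lambda>g. cmod (\<eta> g)) F"
    unfolding U using matrix_boundD[OF assms F, of "\<lambda>h. U h * \<xi> h" "\<lambda>g. U g * \<eta> g"]
    by (simp add: n norm_mult mult_ac)
qed

text \<open>
  Landau's inequality for the derivatives at \<open>0\<close> of the trigonometric polynomial
  \<open>u \<mapsto> \<langle>exp (iuD) m exp (-iuD) \<xi>, \<eta>\<rangle>\<close>, whose \<open>j\<close>-th derivative has the matrix entries
  \<open>i\<^sup>j (l g - l h)\<^sup>j m g h\<close> up to conjugation by the unitary \<open>exp (iuD)\<close>.
\<close>

lemma matrix_bound_landau:
  fixes l :: "'a \<Rightarrow> real"
  assumes A: "matrix_bound A m" and B: "matrix_bound B (\<lambda>g h. of_real (l g - l h) ^ 2 * m g h)"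
    and t: "0 < t"
  shows "matrix_bound (2 / t * A + t * B) (\<lambda>g h. of_real (l g - l h) * m g h)"
  unfolding matrix_bound_def
proof (intro allI impI)
  fix F :: "'a set" and \<xi> \<eta> :: "'a \<Rightarrow> complex"
  assume F: "finite F"
  define N where "N = L2_set (\<lambda>h. cmod (\<xi> h)) F * L2_set (\<lambda>g. cmod (\<eta> g)) F"
  define e where "e n u = (\<Sum>g\<in>F. \<Sum>h\<in>F.
      exp (\<i> * of_real (u * (l g - l h))) * n g h * \<xi> h * cnj (\<eta> g))" for n and u :: real
  have bound: "cmod (e n u) \<le> M * N" if "matrix_bound M n" for M n u
    using matrix_boundD[OF matrix_bound_conjugate[OF that, of u l] F, of \<xi> \<eta>]
    by (simp add: e_def N_def mult.assoc)
  have deriv: "(e n has_vector_derivative e (\<lambda>g h. \<i> * (of_real (l g - l h) * n g h)) u)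
      (at u within S)" for n u S
  proof -
    have "((\<lambda>u. exp (\<i> * of_real (u * c))) has_vector_derivative
        exp (\<i> * of_real (u * c)) * (\<i> * of_real c)) (at u within S)" for c
      using exp_scaleR_has_vector_derivative_right[of "\<i> * of_real c" u S]
      by (simp add: scaleR_conv_of_real mult_ac)
    note * = has_vector_derivative_mult_left[OF this]
    have "(e n has_vector_derivative (\<Sum>g\<in>F. \<Sum>h\<in>F. exp (\<i> * of_real (u * (l g - l h))) *
        (\<i> * of_real (l g - l h)) * (n g h * \<xi> h * cnj (\<eta> g)))) (at u within S)"
      unfolding e_def mult.assoc by (intro has_vector_derivative_sum *[unfolded mult.assoc])
    then show ?thesis by (simp only: e_def mult_ac)
  qed
  define m1 where "m1 g h = \<i> * (of_real (l g - l h) * m g h)" for g h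
  define m2 where "m2 g h = \<i> * (of_real (l g - l h) * m1 g h)" for g h
  have B2: "matrix_bound B m2"
    using matrix_bound_cmult[OF B, of "-1"] by (simp add: m2_def[abs_def] m1_def power2_eq_square mult_ac)
  have BN: "0 \<le> B * N" using bound[OF B2, of 0] norm_ge_zero order_trans by blast
  \<comment> \<open>Mean value inequality for the first derivative \<open>e m1\<close>, whose own
    derivative \<open>e m2\<close> is bounded by \<open>B * N\<close>.\<close>
  have "norm (e m1 x - e m1 0) \<le> B * N * t" if "x \<in> {0..t}" for x
  proof -
    have "norm (e m1 x - e m1 0) \<le> B * N * norm (x - 0)"
    proof (rule differentiable_bound)
      show "(e m1 has_derivative (\<lambda>h. h *\<^sub>R e m2 u)) (at u within {0..t})" for u
        using deriv[of m1] unfolding m2_def[abs_def] has_vector_derivative_def .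
      show "onorm (\<lambda>h. h *\<^sub>R e m2 u) \<le> B * N" for u
        using bound[OF B2, of u] BN by (intro onorm_bound)
          (simp_all add: mult.commute[of _ "\<bar>_\<bar>"] mult_left_mono)
    qed (use that t in auto)
    also have "\<dots> \<le> B * N * t"
      using that BN by (intro mult_left_mono) auto
    finally show ?thesis .
  qed
  \<comment> \<open>The first order remainder on \<open>{0..t}\<close> is at most \<open>t\<close>
    times the oscillation of the derivative there, which contributes the summand
    \<open>t * B\<close>. The two values \<open>e m t\<close> and \<open>e m 0\<close> contribute
    \<open>2 / t * A\<close>.\<close>
  then have "norm (e m t - e m 0 - (t - 0) *\<^sub>R e m1 0) \<le> norm (t - 0) * (B * N * t)"
    using t deriv[of m] unfolding m1_def[abs_def, symmetric]
    by (intro vector_differentiable_bound_linearization[where S = "{0..t}"])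
      (auto simp: closed_segment_eq_real_ivl)
  moreover have "norm z \<le> norm x + norm y + norm (x - y - z)" for x y z :: complex
    by norm
  from this[of "(t - 0) *\<^sub>R e m1 0" "e m t" "e m 0"]
  have "norm ((t - 0) *\<^sub>R e m1 0) \<le>
      norm (e m t) + norm (e m 0) + norm (e m t - e m 0 - (t - 0) *\<^sub>R e m1 0)" .
  ultimately have "t * cmod (e m1 0) \<le> A * N + A * N + t * (B * N * t)"
    using bound[OF A, of t] bound[OF A, of 0] t by simp
  then have "cmod (e m1 0) \<le> (A * N + A * N + t * (B * N * t)) / t"
    using t by (simp add: pos_le_divide_eq mult.commute)
  also have "\<dots> = (2 / t * A + t * B) * N"
    using t by (simp add: field_simps)
  also have "e m1 0 = \<i> * (\<Sum>g\<in>F. \<Sum>h\<in>F. of_real (l g - l h) * m g h * \<xi> h * cnj (\<eta> g))"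
    by (simp add: e_def m1_def sum_distrib_left mult_ac)
  finally show "cmod (\<Sum>g\<in>F. \<Sum>h\<in>F. of_real (l g - l h) * m g h * \<xi> h * cnj (\<eta> g)) \<le>
      (2 / t * A + t * B) * L2_set (\<lambda>h. cmod (\<xi> h)) F * L2_set (\<lambda>g. cmod (\<eta> g)) F"
    by (simp add: norm_mult N_def mult.assoc)
qed

text \<open>Estimates between three neighbouring terms are chained into control of every term by the
  two end terms. Stated for arbitrary number sequences, it makes \<open>c\<close> depend on
  \<open>k\<close> alone, so the resulting bounds are uniform along a sequence of operators.\<close>

lemma landau_iterate:
  "\<exists>c\<ge>1. \<forall>N :: nat \<Rightarrow> real. (\<forall>j. 0 \<le> N j) \<longrightarrow>
     (\<forall>j t. j + 2 \<le> k \<longrightarrow> 0 < t \<longrightarrow> N (Suc j) \<le> 2 / t * N j + t * N (j + 2)) \<longrightarrow>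
     (\<forall>j\<le>k. N j \<le> c * (N 0 + N k))"
proof (induction k)
  case 0
  then show ?case by (intro exI[of _ 1]) auto
next
  case (Suc k)
  then obtain c where c: "c \<ge> 1" and IH: "\<And>N j. (\<And>j. 0 \<le> N j) \<Longrightarrow>
     (\<And>j t. j + 2 \<le> k \<Longrightarrow> 0 < t \<Longrightarrow> N (Suc j) \<le> 2 / t * N j + t * N (j + 2)) \<Longrightarrow>
     j \<le> k \<Longrightarrow> (N j :: real) \<le> c * (N 0 + N k)"
    by blast
  show ?case
  \<comment> \<open>The final estimate produces the coefficients \<open>2 * c\<close> for
    \<open>N 0\<close> and \<open>8 * c\<^sup>2\<close> for the last term;
    \<open>10 * c\<^sup>2\<close> covers both.\<close>
  proof (intro exI[of _ "10 * c\<^sup>2"] conjI allI impI)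
    have "1 \<le> c\<^sup>2" using c by (simp add: one_le_power)
    then show "1 \<le> 10 * c\<^sup>2" by simp
    fix N :: "nat \<Rightarrow> real" and j
    assume N: "\<forall>j. 0 \<le> N j"
      and L: "\<forall>j t. j + 2 \<le> Suc k \<longrightarrow> 0 < t \<longrightarrow> N (Suc j) \<le> 2 / t * N j + t * N (j + 2)"
      and j: "j \<le> Suc k"
    have IH': "N j \<le> c * (N 0 + N k)" if "j \<le> k" for j
      using that N L by (intro IH) auto
    have k: "N k \<le> N 0 + 8 * c * N (Suc k)"
    proof (cases k)
      case 0
      then show ?thesis using N c by simp
    next
      case (Suc i)
      \<comment> \<open>With \<open>t = 4 * c\<close> the term \<open>N i\<close> gets the factor
        \<open>1 / (2 * c)\<close>. After the induction hypothesis \<open>N k\<close> reappears with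
        factor 1/2 and is absorbed into the left side.\<close>
      have "N (Suc i) \<le> 2 / (4 * c) * N i + 4 * c * N (i + 2)"
        using L[rule_format, of i "4 * c"] c Suc by simp
      also have "2 / (4 * c) * N i \<le> 2 / (4 * c) * (c * (N 0 + N k))"
        using IH'[of i] Suc c by (intro mult_left_mono) auto
      also have "\<dots> = (N 0 + N k) / 2" using c by (simp add: field_simps)
      finally show ?thesis using Suc by (simp add: field_simps)
    qed
    have sq: "c \<le> c\<^sup>2" using c by (simp add: power2_eq_square)
    show "N j \<le> 10 * c\<^sup>2 * (N 0 + N (Suc k))"
    proof (cases "j = Suc k")
      case True
      have "1 * N (Suc k) \<le> 10 * c\<^sup>2 * (N 0 + N (Suc k))"
        using N \<open>1 \<le> c\<^sup>2\<close> by (intro mult_mono) auto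
      with True show ?thesis by simp
    next
      case False
      then have "N j \<le> c * (N 0 + N k)" using j IH' by simp
      also have "\<dots> \<le> c * (N 0 + (N 0 + 8 * c * N (Suc k)))"
        using k c by (intro mult_left_mono) auto
      also have "\<dots> = 2 * c * N 0 + 8 * c\<^sup>2 * N (Suc k)"
        by (simp add: power2_eq_square algebra_simps)
      also have "\<dots> \<le> 10 * c\<^sup>2 * N 0 + 10 * c\<^sup>2 * N (Suc k)"
        using N sq \<open>1 \<le> c\<^sup>2\<close> by (intro add_mono mult_right_mono) auto
      finally show ?thesis by (simp add: algebra_simps)
    qed
  qed
qed

section \<open>Generated C*-algebras\<close>

lemma closed_bounded_ops: "closed (bounded_ops :: ('a l2 \<Rightarrow>\<^sub>L 'a l2) set)"
proof -
  have "bounded_linear (scaleC_l2 c :: 'a l2 \<Rightarrow> 'a l2)" for c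
    using bounded_linear.bounded_linear[OF blinfun.bounded_linear_right[of "scalar_op c"]]
    by (simp add: scalar_op.rep_eq)
  then show ?thesis
    unfolding bounded_ops_def
    by (intro closed_Collect_all closed_Collect_eq continuous_intros
        bounded_linear.continuous_on[of "scaleC_l2 _"]) auto
qed

lemma cstar_subalgebra_bounded_ops: "cstar_subalgebra bounded_ops"
  unfolding cstar_subalgebra_def
proof (intro conjI ballI allI impI)
  fix a b :: "'a l2 \<Rightarrow>\<^sub>L 'a l2" and c
  assume a: "a \<in> bounded_ops"
  show "scalar_op c o\<^sub>L a \<in> bounded_ops"
    using a by (auto intro!: l2_eqI simp: bounded_ops_def scalar_op.rep_eq scaleC_l2.rep_eq)
  assume b: "b \<in> bounded_ops"
  show "a + b \<in> bounded_ops" using a b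
    by (auto simp: bounded_ops_def blinfun.add_left)
      (auto intro!: l2_eqI simp: scaleC_l2.rep_eq plus_l2.rep_eq algebra_simps)
  show "a o\<^sub>L b \<in> bounded_ops" using a b by (simp add: bounded_ops_def)
next
  show "(0 :: 'a l2 \<Rightarrow>\<^sub>L 'a l2) \<in> bounded_ops"
    by (auto intro!: l2_eqI simp: bounded_ops_def scaleC_l2.rep_eq zero_l2.rep_eq)
qed (auto simp: closed_bounded_ops)

lemma cstar_subalgebraD:
  assumes "cstar_subalgebra A"
  shows "A \<subseteq> bounded_ops" "closed A" "0 \<in> A"
    and "a \<in> A \<Longrightarrow> b \<in> A \<Longrightarrow> a + b \<in> A"
    and "a \<in> A \<Longrightarrow> scalar_op c o\<^sub>L a \<in> A"
    and "a \<in> A \<Longrightarrow> b \<in> A \<Longrightarrow> a o\<^sub>L b \<in> A"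
    and "a \<in> A \<Longrightarrow> b \<in> bounded_ops \<Longrightarrow> is_adjoint a b \<Longrightarrow> b \<in> A"
  using assms unfolding cstar_subalgebra_def by simp_all

text \<open>All closure properties pass to intersections. As
  \<open>S \<subseteq> bounded_ops\<close>, the algebra \<open>bounded_ops\<close> is itself one of
  the sets intersected, which keeps the intersection inside it.\<close>

lemma cstar_subalgebra_generated:
  assumes "S \<subseteq> bounded_ops"
  shows "cstar_subalgebra (cstar_generated S)"
proof -
  have mem: "a \<in> cstar_generated S \<longleftrightarrow> (\<forall>A. cstar_subalgebra A \<longrightarrow> S \<subseteq> A \<longrightarrow> a \<in> A)" for a
    by (auto simp: cstar_generated_def)
  have sub: "cstar_generated S \<subseteq> bounded_ops"
    using assms cstar_subalgebra_bounded_ops by (auto simp: mem)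
  have cl: "closed (cstar_generated S)"
    unfolding cstar_generated_def by (intro closed_Inter ballI) (simp add: cstar_subalgebraD(2))
  show ?thesis
    unfolding cstar_subalgebra_def
  proof (intro conjI sub cl ballI allI impI; unfold mem; intro allI impI)
    fix A :: "('a l2 \<Rightarrow>\<^sub>L 'a l2) set"
    assume A: "cstar_subalgebra A" "S \<subseteq> A"
    note D = cstar_subalgebraD(3-)[OF A(1)]
    show "0 \<in> A" by (rule D)
    fix a b :: "'a l2 \<Rightarrow>\<^sub>L 'a l2" and c
    assume a: "\<forall>A. cstar_subalgebra A \<longrightarrow> S \<subseteq> A \<longrightarrow> a \<in> A"
    then have a: "a \<in> A" using A by simp
    then show "scalar_op c o\<^sub>L a \<in> A" by (rule D)
    show "b \<in> A" if "b \<in> bounded_ops" "is_adjoint a b" using a that by (rule D)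
    assume "\<forall>A. cstar_subalgebra A \<longrightarrow> S \<subseteq> A \<longrightarrow> b \<in> A"
    then have b: "b \<in> A" using A by simp
    show "a + b \<in> A" using a b by (rule D)
    show "a o\<^sub>L b \<in> A" using a b by (rule D)
  qed
qed

text \<open>Membership of the limit in the domain asks for boundedness at every stage, whereas
  \<open>lip_ball\<close> bounds only the last commutator. The work therefore lies in bounding the
  stages in between uniformly along the sequence.\<close>

lemma lip_lower_semicontinuous:
  fixes l :: "'g::group_add \<Rightarrow> real"
  assumes R: "(reduced_cstar :: ('g l2 \<Rightarrow>\<^sub>L 'g l2) set) \<subseteq> bounded_ops"
  shows "lip_lower_semicontinuous l k"
  unfolding lip_lower_semicontinuous_def closedin_limpt
proof (intro conjI allI impI)
  show "lip_ball l k \<subseteq> reduced_cstar" by (auto simp: lip_ball_def lip_domain_def)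
  fix a :: "'g l2 \<Rightarrow>\<^sub>L 'g l2"
  assume "a islimpt lip_ball l k \<and> a \<in> reduced_cstar"
  then obtain f where f: "\<And>n. f n \<in> lip_ball l k" "f \<longlonglongrightarrow> a" and aR: "a \<in> reduced_cstar"
    unfolding islimpt_sequential by blast
  then have a: "a \<in> bounded_ops" using R by auto
  define N where "N n j = (if j \<le> k then norm ((commutator l ^^ j) (f n)) else 0)" for n j
  have fb: "f n \<in> bounded_ops"
    "\<And>j. j < k \<Longrightarrow> commutator_bounded l ((commutator l ^^ j) (f n))" for n
    using f(1)[of n] R by (auto simp: lip_ball_def lip_domain_def)
  have comm: "(commutator l ^^ j) (f n) \<in> bounded_ops"
    "\<And>g h. entry ((commutator l ^^ j) (f n)) g h = of_real (l g - l h) ^ j * entry (f n) g h"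
    if "j \<le> k" for n j
    by (rule iterated_commutator[OF fb(1)], rule fb(2), use that in simp)+
  have mb: "matrix_bound (N n j) (\<lambda>g h. of_real (l g - l h) ^ j * entry (f n) g h)"
    if "j \<le> k" for n j
  proof -
    have "entry ((commutator l ^^ j) (f n)) = (\<lambda>g h. of_real (l g - l h) ^ j * entry (f n) g h)"
      by (intro ext comm(2) that)
    then show ?thesis
      using matrix_bound_norm[OF comm(1)[OF that, of n]] that by (simp only: N_def if_True)
  qed
  \<comment> \<open>Landau's inequality is applied to the matrix of the \<open>j\<close>-th
    commutator, whose product with \<open>(l g - l h) ^ 2\<close> is the matrix at stage
    \<open>j + 2\<close>.\<close>
  have landau: "N n (Suc j) \<le> 2 / t * N n j + t * N n (j + 2)" if "j + 2 \<le> k" "0 < t" for n j t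
  proof -
    have "matrix_bound (2 / t * N n j + t * N n (j + 2))
        (\<lambda>g h. of_real (l g - l h) * (of_real (l g - l h) ^ j * entry (f n) g h))"
      using mb[of j n] mb[of "j + 2" n] that
      by (intro matrix_bound_landau) (simp_all add: power_add power2_eq_square mult_ac)
    also have "(\<lambda>g h. of_real (l g - l h) * (of_real (l g - l h) ^ j * entry (f n) g h)) =
        entry ((commutator l ^^ Suc j) (f n))"
      using that by (intro ext) (simp only: comm(2)[of "Suc j"] power_Suc mult.assoc)
    finally have "norm ((commutator l ^^ Suc j) (f n)) \<le> 2 / t * N n j + t * N n (j + 2)"
      using that by (intro norm_le_matrix_bound comm) (simp_all add: N_def)
    then show ?thesis using that by (simp add: N_def)
  qed
  obtain c where c1: "c \<ge> 1" and c: "\<forall>N :: nat \<Rightarrow> real. (\<forall>j. 0 \<le> N j) \<longrightarrow>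
     (\<forall>j t. j + 2 \<le> k \<longrightarrow> 0 < t \<longrightarrow> N (Suc j) \<le> 2 / t * N j + t * N (j + 2)) \<longrightarrow>
     (\<forall>j\<le>k. N j \<le> c * (N 0 + N k))"
    using landau_iterate[of k] by blast
  have "\<forall>j. 0 \<le> N n j" for n by (simp add: N_def)
  then have Nc: "N n j \<le> c * (N n 0 + N n k)" if "j \<le> k" for n j
    using landau that by (intro c[rule_format]) simp_all
  \<comment> \<open>The convergent sequence is norm bounded, which controls stage 0; the Lip ball
    controls stage \<open>k\<close>.\<close>
  obtain K where K: "\<And>n. norm (f n) \<le> K"
    using f(2)[THEN convergentI, THEN convergent_imp_Bseq] unfolding Bseq_def by blast
  have N1: "N n k \<le> 1" for n
    using f(1)[of n] by (auto simp: N_def lip_ball_def lip_def)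
  have NK: "N n j \<le> c * (K + 1)" if "j \<le> k" for n j
  proof -
    have "c * (N n 0 + N n k) \<le> c * (K + 1)"
      using K[of n] c1 N1[of n] by (intro mult_left_mono add_mono) (simp_all add: N_def)
    with Nc[OF that, of n] show ?thesis by simp
  qed
  have lim: "(\<lambda>n. of_real (l g - l h) ^ j * entry (f n) g h) \<longlonglongrightarrow> of_real (l g - l h) ^ j * entry a g h"
    for g h j
    by (intro tendsto_intros tendsto_entry f)
  have "commutator_bounded l ((commutator l ^^ j) a)" if "j < k" for j
  proof (rule iterated_commutator_bounded[OF a _ _ that])
    have "0 \<le> K" using K norm_ge_zero order_trans by blast
    then show "0 \<le> c * (K + 1)" using c1 by simp
    show "matrix_bound (c * (K + 1)) (\<lambda>g h. of_real (l g - l h) ^ i * entry a g h)"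
      if "i \<le> k" for i
      by (rule matrix_bound_tendsto[OF _ lim]) (use mb NK that matrix_bound_mono in blast)
  qed
  note dom = this
  have "norm ((commutator l ^^ k) a) \<le> 1"
  proof (rule norm_le_matrix_bound)
    show "(commutator l ^^ k) a \<in> bounded_ops"
      using dom by (rule iterated_commutator[OF a])
    \<comment> \<open>At stage \<open>k\<close> every member of the sequence has bound 1, so the
      limit inherits exactly 1 and not merely \<open>c * (K + 1)\<close>.\<close>
    have "matrix_bound 1 (\<lambda>g h. of_real (l g - l h) ^ k * entry a g h)"
      by (rule matrix_bound_tendsto[OF _ lim]) (use mb N1 matrix_bound_mono in blast)
    also have "(\<lambda>g h. of_real (l g - l h) ^ k * entry a g h) = entry ((commutator l ^^ k) a)"
      using dom by (intro ext iterated_commutator(2)[OF a, symmetric])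
    finally show "matrix_bound 1 (entry ((commutator l ^^ k) a))" .
  qed simp
  with dom show "a \<in> lip_ball l k"
    using aR by (simp add: lip_ball_def lip_domain_def lip_def)
qed

section \<open>Rapid decay and the reduced group C*-algebra\<close>

lemma cinner_fin_l2:
  assumes "finite F"
  shows "cinner \<xi> (fin_l2 F f) = (\<Sum>g\<in>F. l2_apply \<xi> g * cnj (f g))"
proof -
  have "cinner \<xi> (fin_l2 F f) = (\<Sum>\<^sub>\<infinity>g\<in>F. l2_apply \<xi> g * cnj (f g))"
    unfolding cinner.rep_eq by (rule infsum_cong_neutral) (auto simp: l2_apply_fin assms)
  then show ?thesis using assms by simp
qed

lemma cinner_unit_l2: "cinner \<xi> (unit_l2 g) = l2_apply \<xi> g"
  by (simp add: unit_l2_eq_fin_l2 cinner_fin_l2)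

text \<open>The imaginary part is the real inner product with a rotated second argument. Continuity
  of \<open>cinner\<close> thus follows from that of \<open>inner\<close>.\<close>

lemma cinner_eq_inner:
  "cinner f g = Complex (inner f g) (inner f (blinfun_apply (scalar_op \<i>) g))"
proof -
  have "cinner f (scaleC_l2 \<i> g) = - \<i> * cinner f g"
    unfolding cinner.rep_eq scaleC_l2.rep_eq infsum_cmult_right'[symmetric]
    by (simp add: mult_ac)
  then show ?thesis
    by (simp add: complex_eq_iff inner_l2_def scalar_op.rep_eq)
qed

lemma tendsto_cinner:
  assumes "(f \<longlongrightarrow> \<xi>) F" "(g \<longlongrightarrow> \<eta>) F"
  shows "((\<lambda>x. cinner (f x) (g x)) \<longlongrightarrow> cinner \<xi> \<eta>) F"
  unfolding cinner_eq_inner by (intro tendsto_Complex tendsto_intros assms)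

lemma is_adjoint_entry:
  assumes "is_adjoint a b"
  shows "entry b g h = cnj (entry a h g)"
proof -
  have "cinner (blinfun_apply a (unit_l2 g)) (unit_l2 h)
      = cinner (unit_l2 g) (blinfun_apply b (unit_l2 h))"
    using assms unfolding is_adjoint_def by blast
  then show ?thesis
    by (simp add: cinner_unit_l2 cinner_commute[of "unit_l2 g"] entry_def)
qed

text \<open>For truncated vectors both sides are the same finite double sum in two orders;
  continuity of the inner product does the rest.\<close>

lemma is_adjointI:
  assumes a: "a \<in> bounded_ops" and b: "b \<in> bounded_ops"
    and e: "\<And>g h. entry b g h = cnj (entry a h g)"
  shows "is_adjoint a b"
  unfolding is_adjoint_def
proof (intro allI)
  fix \<xi> \<eta>
  let ?fa = "finite_subsets_at_top UNIV"
  have eq: "cinner (blinfun_apply a (fin_l2 F (l2_apply \<xi>))) (fin_l2 F (l2_apply \<eta>)) =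
      cinner (fin_l2 F (l2_apply \<xi>)) (blinfun_apply b (fin_l2 F (l2_apply \<eta>)))"
    if F: "finite F" for F
    unfolding cinner_commute[of "fin_l2 F (l2_apply \<xi>)"] cinner_fin_l2[OF F] apply_fin_l2[OF a]
      apply_fin_l2[OF b] e
    by (simp add: sum_distrib_right, subst sum.swap) (simp add: mult_ac)
  have "((\<lambda>F. cinner (blinfun_apply a (fin_l2 F (l2_apply \<xi>))) (fin_l2 F (l2_apply \<eta>))) \<longlongrightarrow>
      cinner (blinfun_apply a \<xi>) \<eta>) ?fa"
    by (intro tendsto_cinner tendsto_intros tendsto_fin_l2)
  moreover have "\<forall>\<^sub>F F in ?fa.
      cinner (blinfun_apply a (fin_l2 F (l2_apply \<xi>))) (fin_l2 F (l2_apply \<eta>)) =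
      cinner (fin_l2 F (l2_apply \<xi>)) (blinfun_apply b (fin_l2 F (l2_apply \<eta>)))"
    by (rule eventually_finite_subsets_at_top_weakI) (rule eq)
  ultimately have l: "((\<lambda>F. cinner (fin_l2 F (l2_apply \<xi>)) (blinfun_apply b (fin_l2 F (l2_apply \<eta>)))) \<longlongrightarrow>
      cinner (blinfun_apply a \<xi>) \<eta>) ?fa"
    by (simp add: tendsto_cong)
  have "((\<lambda>F. cinner (fin_l2 F (l2_apply \<xi>)) (blinfun_apply b (fin_l2 F (l2_apply \<eta>)))) \<longlongrightarrow>
      cinner \<xi> (blinfun_apply b \<eta>)) ?fa"
    by (intro tendsto_cinner tendsto_intros tendsto_fin_l2)
  with l show "cinner (blinfun_apply a \<xi>) \<eta> = cinner \<xi> (blinfun_apply b \<eta>)"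
    by (rule tendsto_unique[OF finite_subsets_at_top_neq_bot])
qed

section \<open>The group algebra inside the reduced C*-algebra\<close>

lemma entry_translation_op: "entry (translation_op g) x h = of_bool (x = g + h)"
proof -
  have "- g + x = h \<longleftrightarrow> x = g + h" by (metis add.assoc add.left_inverse add_0 minus_add_cancel)
  then show ?thesis
    by (simp add: entry_def translation_op.rep_eq translate.rep_eq unit_l2.rep_eq)
qed

lemma translation_op_bounded_ops: "translation_op g \<in> bounded_ops"
  by (auto intro!: l2_eqI
      simp: bounded_ops_def translation_op.rep_eq translate.rep_eq scaleC_l2.rep_eq)

lemma norm_translation_op_le: "norm (translation_op g) \<le> 1"
  by (rule norm_blinfun_bound) (simp_all add: translation_op.rep_eq norm_translate)

lemma cstar_subalgebra_sum:
  assumes "cstar_subalgebra A" "\<And>x. x \<in> F \<Longrightarrow> f x \<in> A"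
  shows "sum f F \<in> A"
  using assms(2)
  by (induction F rule: infinite_finite_induct) (simp_all add: cstar_subalgebraD[OF assms(1)])

lemmas bounded_ops_intros = cstar_subalgebraD(3-6)[OF cstar_subalgebra_bounded_ops]

lemma left_regular_bounded_ops: "left_regular x \<in> bounded_ops"
  unfolding left_regular_def
  by (intro cstar_subalgebra_sum cstar_subalgebraD(5) cstar_subalgebra_bounded_ops
      translation_op_bounded_ops)

lemma entry_sum: "entry (sum f A) g h = (\<Sum>x\<in>A. entry (f x) g h)"
  by (simp add: entry_def blinfun.sum_left l2_apply_sum)

lemma entry_left_regular: "entry (left_regular x) g h = Poly_Mapping.lookup x (g - h)"
proof -
  have "entry (left_regular x) g h =
      (\<Sum>k\<in>Poly_Mapping.keys x. Poly_Mapping.lookup x k * of_bool (g = k + h))"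
    by (simp add: left_regular_def entry_sum entry_scalar_op entry_translation_op)
  also have "\<dots> = (\<Sum>k\<in>Poly_Mapping.keys x. if k = g - h then Poly_Mapping.lookup x k else 0)"
    by (rule sum.cong) (auto simp: eq_diff_eq)
  also have "\<dots> = Poly_Mapping.lookup x (g - h)"
    by (simp add: in_keys_iff)
  finally show ?thesis .
qed

lemma left_regular_eqI:
  assumes "a \<in> bounded_ops" "\<And>g h. entry a g h = Poly_Mapping.lookup x (g - h)"
  shows "left_regular x = a"
  using assms by (intro bounded_ops_eqI left_regular_bounded_ops) (simp_all add: entry_left_regular)

lemma left_regular_add: "left_regular (x + y) = left_regular x + left_regular y"
  by (intro left_regular_eqI bounded_ops_intros
      left_regular_bounded_ops) (simp add: entry_add entry_left_regular lookup_add)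

lemma left_regular_single: "left_regular (Poly_Mapping.single g c) = scalar_op c o\<^sub>L translation_op g"
  by (intro left_regular_eqI bounded_ops_intros
      translation_op_bounded_ops)
    (auto simp: entry_scalar_op entry_translation_op lookup_single when_def eq_diff_eq)

lemma left_regular_zero: "left_regular 0 = 0"
  by (simp add: left_regular_def)

lemma left_regular_sum: "left_regular (sum f A) = (\<Sum>x\<in>A. left_regular (f x))"
  by (induction A rule: infinite_finite_induct) (simp_all add: left_regular_zero left_regular_add)

lemma left_regular_scale: "scalar_op c o\<^sub>L left_regular x \<in> range left_regular"
proof -
  have "left_regular (Poly_Mapping.map ((*) c) x) = scalar_op c o\<^sub>L left_regular x"
    by (intro left_regular_eqI bounded_ops_intros
      left_regular_bounded_ops)
     (simp add: entry_scalar_op entry_left_regular map.rep_eq when_def)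
  then show ?thesis by (metis rangeI)
qed

lemma translation_op_mult: "translation_op g o\<^sub>L translation_op h = translation_op (g + h)"
  by (intro bounded_ops_eqI bounded_ops_intros
      translation_op_bounded_ops)
    (simp add: entry_def translation_op.rep_eq translate.rep_eq unit_l2.rep_eq minus_add add.assoc
      diff_conv_add_uminus del: add_uminus_conv_diff)

lemma left_regular_mult: "left_regular x o\<^sub>L left_regular y \<in> range left_regular"
proof -
  have m: "(scalar_op c o\<^sub>L translation_op g) o\<^sub>L (scalar_op c' o\<^sub>L translation_op h) =
      left_regular (Poly_Mapping.single (g + h) (c * c'))" for c c' and g h :: 'a
    unfolding left_regular_single translation_op_mult[symmetric]
    by (rule blinfun_eqI, rule l2_eqI)
      (simp add: scalar_op.rep_eq translation_op.rep_eq scaleC_l2.rep_eq translate.rep_eq)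
  have "left_regular x o\<^sub>L left_regular y = (\<Sum>g\<in>Poly_Mapping.keys x. \<Sum>h\<in>Poly_Mapping.keys y.
      left_regular (Poly_Mapping.single (g + h) (Poly_Mapping.lookup x g * Poly_Mapping.lookup y h)))"
    unfolding left_regular_def[of x] left_regular_def[of y]
    by (subst sum.swap) (simp add: m bounded_bilinear.sum_left[OF bounded_bilinear_blinfun_compose]
        bounded_bilinear.sum_right[OF bounded_bilinear_blinfun_compose])
  then show ?thesis
    by (simp flip: left_regular_sum)
qed

text \<open>The witness is the involution of the group algebra, which sends the coefficient function
  \<open>x\<close> to \<open>g \<mapsto> cnj (x (- g))\<close>.\<close>

lemma left_regular_adjoint:
  obtains y where "\<And>g h. entry (left_regular y) g h = cnj (entry (left_regular x) h g)"
proof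
  fix g h
  let ?y = "\<Sum>k\<in>Poly_Mapping.keys x. Poly_Mapping.single (- k) (cnj (Poly_Mapping.lookup x k))"
  have "Poly_Mapping.lookup ?y (g - h) =
      (\<Sum>k\<in>Poly_Mapping.keys x. if k = h - g then cnj (Poly_Mapping.lookup x k) else 0)"
    unfolding lookup_sum lookup_single when_def
    by (rule sum.cong) (auto simp: minus_equation_iff[of _ "g - h"])
  then show "entry (left_regular ?y) g h = cnj (entry (left_regular x) h g)"
    by (simp add: entry_left_regular in_keys_iff)
qed

lemma norm_le_adjoint:
  assumes "a \<in> bounded_ops" "b \<in> bounded_ops" "\<And>g h. entry b g h = cnj (entry a h g)"
  shows "norm b \<le> norm a"
proof (rule norm_le_matrix_bound[OF assms(2)])
  have "entry b = (\<lambda>g h. cnj (entry a h g))" by (intro ext assms(3))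
  then show "matrix_bound (norm a) (entry b)"
    using matrix_bound_adjoint[OF matrix_bound_norm[OF assms(1)]] by simp
qed simp

lemma bounded_ops_diff: "a \<in> bounded_ops \<Longrightarrow> b \<in> bounded_ops \<Longrightarrow> a - b \<in> bounded_ops"
  by (auto intro!: l2_eqI simp: bounded_ops_def blinfun.diff_left scaleC_l2.rep_eq minus_l2.rep_eq
      right_diff_distrib)

text \<open>The algebraic operations are continuous and so pass to limits. For adjoints, an element
  \<open>x\<close> near \<open>a\<close> has its involution \<open>y\<close> equally near
  \<open>b\<close>, because passing to the adjoint does not increase the norm of a
  difference.\<close>

lemma cstar_subalgebra_closure_range_left_regular:
  "cstar_subalgebra (closure (range (left_regular :: ('g::group_add \<Rightarrow>\<^sub>0 complex) \<Rightarrow> _)))"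
  unfolding cstar_subalgebra_def
proof (intro conjI ballI allI impI)
  let ?R = "range (left_regular :: ('g \<Rightarrow>\<^sub>0 complex) \<Rightarrow> _)"
  show sub: "closure ?R \<subseteq> bounded_ops"
    using left_regular_bounded_ops by (intro closure_minimal closed_bounded_ops) auto
  show "0 \<in> closure ?R"
    using closure_subset left_regular_zero by (metis rangeI subset_iff)
  fix a b c
  assume "a \<in> closure ?R"
  then obtain f where f: "\<And>n. f n \<in> ?R" "f \<longlonglongrightarrow> a"
    by (auto simp: closure_sequential)
  show "scalar_op c o\<^sub>L a \<in> closure ?R"
    unfolding closure_sequential
  proof (intro exI conjI allI)
    show "scalar_op c o\<^sub>L f n \<in> ?R" for n
      using f(1)[of n] left_regular_scale by auto
    show "(\<lambda>n. scalar_op c o\<^sub>L f n) \<longlonglongrightarrow> (scalar_op c o\<^sub>L a)"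
      by (intro tendsto_intros f)
  qed
  show "b \<in> closure ?R" if b: "b \<in> bounded_ops" and ab: "is_adjoint a b"
    unfolding closure_approachable
  proof (intro allI impI)
    fix e :: real assume "0 < e"
    then obtain x where x: "dist (left_regular x) a < e"
      using \<open>a \<in> closure ?R\<close> unfolding closure_approachable by blast
    obtain y where y: "\<And>g h. entry (left_regular y) g h = cnj (entry (left_regular x) h g)"
      by (rule left_regular_adjoint[of x]) (rule that)
    have "norm (left_regular y - b) \<le> norm (left_regular x - a)"
      using \<open>a \<in> closure ?R\<close> sub b
      by (intro norm_le_adjoint bounded_ops_diff left_regular_bounded_ops)
        (auto simp: entry_diff y is_adjoint_entry[OF ab])
    with x show "\<exists>z\<in>?R. dist z b < e"
      by (intro bexI[of _ "left_regular y"]) (simp_all add: dist_norm)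
  qed
  assume "b \<in> closure ?R"
  then obtain f' where f': "\<And>n. f' n \<in> ?R" "f' \<longlonglongrightarrow> b"
    by (auto simp: closure_sequential)
  show "a + b \<in> closure ?R"
    unfolding closure_sequential
  proof (intro exI conjI allI)
    show "f n + f' n \<in> ?R" for n
      using f(1)[of n] f'(1)[of n] by (auto simp flip: left_regular_add)
    show "(\<lambda>n. f n + f' n) \<longlonglongrightarrow> a + b"
      by (intro tendsto_intros f f')
  qed
  show "a o\<^sub>L b \<in> closure ?R"
    unfolding closure_sequential
  proof (intro exI conjI allI)
    show "f n o\<^sub>L f' n \<in> ?R" for n
      using f(1)[of n] f'(1)[of n] left_regular_mult by auto
    show "(\<lambda>n. f n o\<^sub>L f' n) \<longlonglongrightarrow> (a o\<^sub>L b)"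
      by (intro tendsto_intros f f')
  qed
qed simp

lemma cstar_subalgebra_reduced_cstar: "cstar_subalgebra reduced_cstar"
  unfolding reduced_cstar_def using left_regular_bounded_ops
  by (intro cstar_subalgebra_generated) auto

lemma left_regular_reduced_cstar: "left_regular x \<in> reduced_cstar"
  by (auto simp: reduced_cstar_def cstar_generated_def)

text \<open>The closure is already a C*-subalgebra, so generation adds nothing to it. Facts about
  \<open>reduced_cstar\<close> can now be checked on \<open>range left_regular\<close> and extended
  by norm limits.\<close>

lemma reduced_cstar_eq_closure: "reduced_cstar = closure (range left_regular)"
proof
  show "reduced_cstar \<subseteq> closure (range left_regular)"
    unfolding reduced_cstar_def cstar_generated_def
    using cstar_subalgebra_closure_range_left_regular closure_subset by blast
  show "closure (range left_regular) \<subseteq> reduced_cstar"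
    using left_regular_reduced_cstar cstar_subalgebraD(2)[OF cstar_subalgebra_reduced_cstar]
    by (intro closure_minimal) auto
qed

text \<open>Entries of group algebra elements depend only on \<open>g - h\<close>, and this survives
  norm limits. An element is thereby determined by its Fourier coefficients, the column at
  0.\<close>

lemma entry_reduced_cstar:
  assumes "a \<in> reduced_cstar"
  shows "entry a g h = entry a (g - h) 0"
proof -
  obtain f where f: "\<And>n. f n \<in> range left_regular" "f \<longlonglongrightarrow> a"
    using assms unfolding reduced_cstar_eq_closure closure_sequential by blast
  have "(\<lambda>n. entry (f n) g h) = (\<lambda>n. entry (f n) (g - h) 0)"
  proof
    show "entry (f n) g h = entry (f n) (g - h) 0" for n
      using f(1)[of n] by (auto simp: entry_left_regular)
  qed
  then show ?thesis
    using tendsto_entry[OF f(2), of g h] tendsto_entry[OF f(2), of "g - h" 0]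
    by (metis LIMSEQ_unique)
qed

section \<open>Truncation of Fourier coefficients and the Lip ball\<close>

definition restrict_poly :: "'g set \<Rightarrow> ('g \<Rightarrow> complex) \<Rightarrow> 'g \<Rightarrow>\<^sub>0 complex" where
  "restrict_poly F f = (\<Sum>g\<in>F. Poly_Mapping.single g (f g))"

lemma lookup_restrict_poly:
  "finite F \<Longrightarrow> Poly_Mapping.lookup (restrict_poly F f) g = (if g \<in> F then f g else 0)"
  by (simp add: restrict_poly_def lookup_sum lookup_single when_def)

lemma keys_restrict_poly: "finite F \<Longrightarrow> Poly_Mapping.keys (restrict_poly F f) \<subseteq> F"
  by (auto simp: in_keys_iff lookup_restrict_poly split: if_splits)

text \<open>The inequality \<open>RD\<close> is available only for finite supports, while the
  remainder may have infinitely many coefficients. Each finite section of the remainder, however,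
  coincides with that of a group algebra element supported off \<open>F\<close>.\<close>

lemma rapid_decay_approx:
  fixes w :: "'g::group_add \<Rightarrow> real"
  assumes C: "0 \<le> C" and w: "\<And>g. 0 \<le> w g"
    and RD: "\<And>x. norm (left_regular x) \<le>
      C * sqrt (\<Sum>g\<in>Poly_Mapping.keys x. w g * (cmod (Poly_Mapping.lookup x g))\<^sup>2)"
    and a: "a \<in> reduced_cstar" and F: "finite F"
    and B: "\<And>E. finite E \<Longrightarrow> E \<inter> F = {} \<Longrightarrow> (\<Sum>g\<in>E. w g * (cmod (entry a g 0))\<^sup>2) \<le> B"
  shows "norm (a - left_regular (restrict_poly F (\<lambda>g. entry a g 0))) \<le> C * sqrt B"
    (is "norm ?d \<le> _")
proof (rule norm_le_matrix_bound)
  show "?d \<in> bounded_ops"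
    using a cstar_subalgebraD(1)[OF cstar_subalgebra_reduced_cstar]
    by (intro bounded_ops_diff left_regular_bounded_ops) auto
  have "0 \<le> B" using B[of "{}"] by simp
  then show "0 \<le> C * sqrt B" using C by simp
  show "matrix_bound (C * sqrt B) (entry ?d)"
    unfolding matrix_bound_def
  proof (intro allI impI)
    fix H :: "'g set" and \<xi> \<eta> :: "'g \<Rightarrow> complex"
    assume H: "finite H"
    \<comment> \<open>Only the coefficients at differences \<open>g - h\<close> with
      \<open>g\<close>, \<open>h\<close> in \<open>H\<close> enter the section; those in
      \<open>F\<close> have been subtracted away.\<close>
    define E where "E = (\<lambda>(g, h). g - h) ` (H \<times> H) - F"
    define y where "y = restrict_poly E (\<lambda>g. entry a g 0)"
    have E: "finite E" using H by (simp add: E_def)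
    have "(\<Sum>g\<in>Poly_Mapping.keys y. w g * (cmod (Poly_Mapping.lookup y g))\<^sup>2)
        \<le> (\<Sum>g\<in>E. w g * (cmod (Poly_Mapping.lookup y g))\<^sup>2)"
      using keys_restrict_poly[OF E] w E unfolding y_def by (intro sum_mono2) auto
    also have "\<dots> = (\<Sum>g\<in>E. w g * (cmod (entry a g 0))\<^sup>2)"
      by (rule sum.cong) (simp_all add: y_def lookup_restrict_poly E)
    also have "\<dots> \<le> B" using E by (intro B) (auto simp: E_def)
    finally have "C * sqrt (\<Sum>g\<in>Poly_Mapping.keys y. w g * (cmod (Poly_Mapping.lookup y g))\<^sup>2)
        \<le> C * sqrt B"
      using C by (intro mult_left_mono) auto
    then have "matrix_bound (C * sqrt B) (entry (left_regular y))"
      using RD[of y] matrix_bound_norm[OF left_regular_bounded_ops] matrix_bound_mono order_trans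
      by blast
    moreover have "entry ?d g h = entry (left_regular y) g h" if "g \<in> H" "h \<in> H" for g h
    proof -
      have "g - h \<in> (\<lambda>(g, h). g - h) ` (H \<times> H)" using that by force
      then show ?thesis
        using F E by (auto simp: entry_diff entry_left_regular y_def lookup_restrict_poly E_def
            entry_reduced_cstar[OF a, of g h])
    qed
    then have "(\<Sum>g\<in>H. \<Sum>h\<in>H. entry ?d g h * \<xi> h * cnj (\<eta> g)) =
        (\<Sum>g\<in>H. \<Sum>h\<in>H. entry (left_regular y) g h * \<xi> h * cnj (\<eta> g))"
      by (intro sum.cong refl) simp
    ultimately show "cmod (\<Sum>g\<in>H. \<Sum>h\<in>H. entry ?d g h * \<xi> h * cnj (\<eta> g)) \<le>
        C * sqrt B * L2_set (\<lambda>h. cmod (\<xi> h)) H * L2_set (\<lambda>g. cmod (\<eta> g)) H"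
      using matrix_boundD[OF _ H] by simp
  qed
qed

text \<open>A single column of the \<open>k\<close>-th commutator has norm at most 1, and
  \<open>l 0 = 0\<close> turns its weights \<open>l g - l 0\<close> into \<open>l g\<close>.\<close>

lemma lip_ball_sum_le:
  fixes l :: "'g::group_add \<Rightarrow> real"
  assumes a: "a \<in> lip_ball l k" and l0: "l 0 = 0" and E: "finite E"
  shows "(\<Sum>g\<in>E. (l g ^ k * cmod (entry a g 0))\<^sup>2) \<le> 1"
proof -
  have "a \<in> bounded_ops" and c: "\<And>j. j < k \<Longrightarrow> commutator_bounded l ((commutator l ^^ j) a)"
    and n: "norm ((commutator l ^^ k) a) \<le> 1"
    using a cstar_subalgebraD(1)[OF cstar_subalgebra_reduced_cstar]
    by (auto simp: lip_ball_def lip_domain_def lip_def)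
  from iterated_commutator(2)[OF this(1) c]
  have e: "cmod (entry ((commutator l ^^ k) a) g 0) = \<bar>l g ^ k * cmod (entry a g 0)\<bar>" for g
    by (simp add: l0 norm_mult norm_power abs_mult power_abs)
  have "L2_set (\<lambda>g. cmod (entry ((commutator l ^^ k) a) g 0)) E \<le> 1"
    using L2_set_le_norm_l2[OF E, of "blinfun_apply ((commutator l ^^ k) a) (unit_l2 0)"]
      norm_blinfun[of "(commutator l ^^ k) a" "unit_l2 0"] n
    by (simp add: entry_def)
  then show ?thesis by (simp only: e L2_set_def power2_abs real_sqrt_le_1_iff)
qed

text \<open>Rapid decay enters the comparison of topologies only through this approximation. The
  error is uniform over the Lip ball; the coefficient at the identity is left uncontrolled because
  the weight \<open>l 0 ^ k\<close> vanishes there.\<close>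

lemma lip_ball_approx:
  fixes l :: "'g::group_add \<Rightarrow> real"
  assumes l: "length_function l" "range l \<subseteq> \<nat>" "l -` {0} = {0}" "proper_length l" "rapid_decay l"
  obtains K k0 where "0 \<le> K" "1 \<le> k0"
    "\<And>k a n. k0 \<le> k \<Longrightarrow> a \<in> lip_ball l k \<Longrightarrow> \<exists>x. norm (a - left_regular x) \<le> K / (real n + 1) \<and>
      Poly_Mapping.keys x \<subseteq> {g. l g \<le> real n} \<and> (\<forall>g. g \<noteq> 0 \<longrightarrow> cmod (Poly_Mapping.lookup x g) \<le> 1)"
proof -
  obtain C s where C: "C > 0" and s: "s > 0" and RD: "\<And>x :: 'g \<Rightarrow>\<^sub>0 complex.
      norm (left_regular x) \<le> C * sqrt (\<Sum>g\<in>Poly_Mapping.keys x.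
        (1 + l g) powr (2 * s) * (cmod (Poly_Mapping.lookup x g))\<^sup>2)"
    using l(5) unfolding rapid_decay_def by blast
  have l0: "l 0 = 0" and pos: "\<And>g. 0 \<le> l g"
    using l(1) by (auto simp: length_function_def)
  have nat: "\<exists>m::nat. l g = real m" for g
    using l(2) by (auto simp: Nats_def subset_iff image_iff)
  have ge: "real n + 1 \<le> l g" if "real n < l g" for g n
    using nat[of g] that by auto
  \<comment> \<open>This makes \<open>k0 \<ge> s + 1\<close>: the exponent \<open>s\<close> is
    needed for rapid decay, and the spare power of \<open>l\<close> yields the decay
    \<open>1 / (n + 1)\<close>.\<close>
  define k0 where "k0 = nat \<lceil>s\<rceil> + 1"
  show ?thesis
  proof
    show "0 \<le> C * 2 powr s" using C by simp
    show "1 \<le> k0" by (simp add: k0_def)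
    fix k a and n :: nat
    assume k: "k0 \<le> k" and a: "a \<in> lip_ball l k"
    have sk: "s + 1 \<le> real k" using k unfolding k0_def by linarith
    define F where "F = {g. l g \<le> real n}"
    have F: "finite F"
    proof -
      \<comment> \<open>Properness is stated for positive radii, so \<open>n + 1\<close> is used to
        include \<open>n = 0\<close>.\<close>
      have "finite (l -` {0..real n + 1})"
        using l(4) unfolding proper_length_def by simp
      then show ?thesis by (rule finite_subset[rotated]) (auto simp: F_def pos)
    qed
    have w: "(1 + l g) powr (2 * s) \<le> (2 powr s / (real n + 1))\<^sup>2 * (l g ^ k)\<^sup>2" if "g \<notin> F" for g
    proof -
      have g: "real n + 1 \<le> l g" using ge that by (simp add: F_def)
      \<comment> \<open>Integer values give \<open>l g \<ge> n + 1 \<ge> 1\<close> off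
        \<open>F\<close>, hence \<open>1 + l g \<le> 2 * l g\<close>. This is the source of the
        constant \<open>2 powr s\<close>.\<close>
      have "(1 + l g) powr (2 * s) \<le> (2 * l g) powr (2 * s)"
        using g s by (intro powr_mono2) auto
      also have "\<dots> = (2 powr s)\<^sup>2 * l g powr (2 * s)"
        using g by (simp add: powr_mult power2_eq_square flip: powr_add)
      finally have 1: "(1 + l g) powr (2 * s) \<le> (2 powr s)\<^sup>2 * l g powr (2 * s)" .
      \<comment> \<open>The spare factor \<open>(l g)\<^sup>2\<close> dominates
        \<open>(n + 1)\<^sup>2\<close>, and \<open>2 * s + 2 \<le> 2 * k\<close> fits it under the
        weight of the Lip ball.\<close>
      have "l g powr (2 * s) * (real n + 1)\<^sup>2 \<le> l g powr (2 * s) * (l g)\<^sup>2"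
        using g by (intro mult_left_mono power_mono) auto
      also have "\<dots> = l g powr (2 * s + 2)"
        using g by (simp add: powr_add powr_numeral)
      also have "\<dots> \<le> l g powr (2 * real k)"
        using g sk by (intro powr_mono) auto
      also have "\<dots> = l g powr real (k * 2)" by (simp add: mult.commute)
      also have "\<dots> = (l g ^ k)\<^sup>2"
        using g by (subst powr_realpow) (simp_all add: power_mult)
      finally have "l g powr (2 * s) \<le> (l g ^ k)\<^sup>2 / (real n + 1)\<^sup>2"
        by (simp add: pos_le_divide_eq)
      from mult_left_mono[OF this, of "(2 powr s)\<^sup>2"] 1 show ?thesis
        by (simp add: power_divide)
    qed
    have "norm (a - left_regular (restrict_poly F (\<lambda>g. entry a g 0))) \<le>
        C * sqrt ((2 powr s / (real n + 1))\<^sup>2)"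
    proof (rule rapid_decay_approx[OF _ _ RD _ F])
      show "a \<in> reduced_cstar" using a by (simp add: lip_ball_def lip_domain_def)
      fix E assume E: "finite E" "E \<inter> F = {}"
      have "(\<Sum>g\<in>E. (1 + l g) powr (2 * s) * (cmod (entry a g 0))\<^sup>2)
          \<le> (\<Sum>g\<in>E. (2 powr s / (real n + 1))\<^sup>2 * (l g ^ k)\<^sup>2 * (cmod (entry a g 0))\<^sup>2)"
        using w E by (intro sum_mono mult_right_mono) auto
      also have "\<dots> = (2 powr s / (real n + 1))\<^sup>2 * (\<Sum>g\<in>E. (l g ^ k * cmod (entry a g 0))\<^sup>2)"
        by (simp add: sum_distrib_left power_mult_distrib mult.assoc)
      also have "\<dots> \<le> (2 powr s / (real n + 1))\<^sup>2 * 1"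
        by (intro mult_left_mono lip_ball_sum_le[OF a l0 E(1)]) simp
      finally show "(\<Sum>g\<in>E. (1 + l g) powr (2 * s) * (cmod (entry a g 0))\<^sup>2)
          \<le> (2 powr s / (real n + 1))\<^sup>2" by simp
    qed (use C in auto)
    moreover have "cmod (entry a g 0) \<le> 1" if "g \<noteq> 0" for g
    proof -
      have "l g \<noteq> 0" using that l(3) by auto
      then have "1 \<le> l g" using nat[of g] by auto
      then have "1 * cmod (entry a g 0) \<le> l g ^ k * cmod (entry a g 0)"
        by (intro mult_right_mono one_le_power) auto
      also have "\<dots> \<le> 1"
        using lip_ball_sum_le[OF a l0, of "{g}"] pos[of g] by (simp add: abs_square_le_1)
      finally show ?thesis by simp
    qed
    ultimately show "\<exists>x. norm (a - left_regular x) \<le> C * 2 powr s / (real n + 1) \<and>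
        Poly_Mapping.keys x \<subseteq> {g. l g \<le> real n} \<and>
        (\<forall>g. g \<noteq> 0 \<longrightarrow> cmod (Poly_Mapping.lookup x g) \<le> 1)"
      using F keys_restrict_poly[OF F]
      by (intro exI[of _ "restrict_poly F (\<lambda>g. entry a g 0)"])
        (simp add: lookup_restrict_poly F_def real_sqrt_unique)
  qed
qed

text \<open>By the triangle inequality \<open>l (g + h)\<close> and \<open>l h\<close> differ by at
  most \<open>l g\<close>, so the \<open>j\<close>-th commutator of a translation has entries of
  modulus at most \<open>l g ^ j\<close>. Dividing by \<open>(1 + l g) ^ k\<close> serves all stages
  \<open>j \<le> k\<close> at once, since the base is at least 1, and also covers
  \<open>g = 0\<close>.\<close>

lemma translation_op_lip_ball:
  fixes l :: "'g::group_add \<Rightarrow> real"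
  assumes l: "length_function l"
  shows "scalar_op (of_real (1 / (1 + l g) ^ k)) o\<^sub>L translation_op g \<in> lip_ball l k"
    (is "?a \<in> _")
proof -
  have R: "?a \<in> reduced_cstar"
    using left_regular_reduced_cstar by (metis left_regular_single)
  then have a: "?a \<in> bounded_ops"
    using cstar_subalgebraD(1)[OF cstar_subalgebra_reduced_cstar] by blast
  have pos: "0 \<le> l g" for g using l by (simp add: length_function_def)
  have mb: "matrix_bound 1 (\<lambda>x h. of_real (l x - l h) ^ j * entry ?a x h)" if j: "j \<le> k" for j
  proof (rule matrix_bound_dominated)
    show "matrix_bound 1 (entry (translation_op g))"
      using matrix_bound_norm[OF translation_op_bounded_ops] norm_translation_op_le
      by (rule matrix_bound_mono)
    show "entry (translation_op g) x h = of_real (of_bool (x = g + h))" for x h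
      by (simp add: entry_translation_op)
    fix x h
    have "\<bar>l x - l h\<bar> ^ j * (1 / (1 + l g) ^ k) \<le> 1" if x: "x = g + h"
    proof -
      have "l x \<le> l g + l h" using l x by (simp add: length_function_def)
      moreover have "l h \<le> l (- g) + l x"
        using l unfolding length_function_def x by (metis minus_add_cancel)
      moreover have "l (- g) = l g" using l by (simp add: length_function_def)
      ultimately have "\<bar>l x - l h\<bar> ^ j \<le> (1 + l g) ^ j"
        by (intro power_mono) auto
      also have "\<dots> \<le> (1 + l g) ^ k" using j pos by (intro power_increasing) auto
      finally show ?thesis using pos[of g] by (simp add: divide_le_eq)
    qed
    moreover have "of_real (l x - l h) ^ j * entry ?a x h =
        of_real ((l x - l h) ^ j * (1 / (1 + l g) ^ k) * of_bool (x = g + h))"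
      by (simp add: entry_scalar_op entry_translation_op)
    ultimately show "cmod (of_real (l x - l h) ^ j * entry ?a x h) \<le> of_bool (x = g + h)"
      using pos[of g] by (simp only: norm_of_real) (auto simp: abs_mult power_abs)
  qed
  have c: "commutator_bounded l ((commutator l ^^ j) ?a)" if "j < k" for j
    using mb that by (intro iterated_commutator_bounded[OF a, of k "\<lambda>_. 1"]) auto
  moreover have "norm ((commutator l ^^ k) ?a) \<le> 1"
  proof (rule norm_le_matrix_bound)
    show "(commutator l ^^ k) ?a \<in> bounded_ops"
      using c by (rule iterated_commutator[OF a])
    have "entry ((commutator l ^^ k) ?a) = (\<lambda>x h. of_real (l x - l h) ^ k * entry ?a x h)"
      using c by (intro ext iterated_commutator(2)[OF a])
    then show "matrix_bound 1 (entry ((commutator l ^^ k) ?a))" using mb[of k] by simp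
  qed simp
  ultimately show ?thesis using R by (simp add: lip_ball_def lip_domain_def lip_def)
qed

section \<open>States and the metric\<close>

lemma scaleR_blinfun_eq: "scalar_op (of_real r) o\<^sub>L a = r *\<^sub>R a"
  by (rule blinfun_eqI, rule l2_eqI)
    (simp add: scalar_op.rep_eq scaleC_l2.rep_eq scaleR_l2.rep_eq blinfun.scaleR_left)

lemma state_space_extensional: "\<phi> \<in> state_space A \<Longrightarrow> \<phi> \<in> extensional A"
  by (simp add: state_space_def)

lemma state_space_linear:
  assumes "\<phi> \<in> state_space A"
  shows "a \<in> A \<Longrightarrow> b \<in> A \<Longrightarrow> \<phi> (a + b) = \<phi> a + \<phi> b"
    and "a \<in> A \<Longrightarrow> \<phi> (scalar_op c o\<^sub>L a) = c * \<phi> a"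
    and "a \<in> A \<Longrightarrow> b \<in> A \<Longrightarrow> is_adjoint a b \<Longrightarrow> \<phi> (b o\<^sub>L a) \<in> \<real>\<^sub>\<ge>\<^sub>0"
  using assms unfolding state_space_def by blast+

lemma state_space_zero:
  assumes "cstar_subalgebra A" "\<phi> \<in> state_space A"
  shows "\<phi> 0 = 0"
  using state_space_linear(1)[OF assms(2), of 0 0] cstar_subalgebraD(3)[OF assms(1)] by simp

lemma state_space_sum:
  assumes A: "cstar_subalgebra A" and \<phi>: "\<phi> \<in> state_space A" and f: "\<And>x. x \<in> F \<Longrightarrow> f x \<in> A"
  shows "\<phi> (sum f F) = (\<Sum>x\<in>F. \<phi> (f x))"
  using f
proof (induction F rule: infinite_finite_induct)
  case (insert x F)
  then show ?case
    using cstar_subalgebra_sum[OF A, of F f] by (simp add: state_space_linear(1)[OF \<phi>])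
qed (simp_all add: state_space_zero[OF A \<phi>])

lemma cstar_subalgebra_diff:
  assumes "cstar_subalgebra A" "a \<in> A" "b \<in> A"
  shows "a - b \<in> A"
proof -
  have "a + (scalar_op (of_real (- 1)) o\<^sub>L b) \<in> A"
    by (intro cstar_subalgebraD(4,5) assms)
  then show ?thesis by (simp only: scaleR_blinfun_eq) simp
qed

lemma state_space_diff:
  assumes A: "cstar_subalgebra A" and \<phi>: "\<phi> \<in> state_space A" and "a \<in> A" "b \<in> A"
  shows "\<phi> (a - b) = \<phi> a - \<phi> b"
  using state_space_linear(1)[OF \<phi> cstar_subalgebra_diff[OF A assms(3,4)] assms(4)] by simp

lemma state_space_norm_le:
  assumes A: "cstar_subalgebra A" and \<phi>: "\<phi> \<in> state_space A" and a: "a \<in> A"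
  shows "cmod (\<phi> a) \<le> norm a"
proof (cases "a = 0")
  case False
  let ?b = "scalar_op (of_real (inverse (norm a))) o\<^sub>L a"
  have "?b \<in> A" by (intro cstar_subalgebraD(5) A a)
  moreover have "norm ?b \<le> 1" using False by (simp only: scaleR_blinfun_eq) simp
  ultimately have "ennreal (cmod (\<phi> ?b)) \<le> (SUP a\<in>{a \<in> A. norm a \<le> 1}. ennreal (cmod (\<phi> a)))"
    by (intro SUP_upper) simp
  also have "\<dots> = 1" using \<phi> by (simp add: state_space_def)
  finally have "cmod (\<phi> ?b) \<le> 1" by simp
  then show ?thesis
    using False by (simp add: state_space_linear(2)[OF \<phi> a] norm_divide divide_simps)
qed (simp add: state_space_zero[OF A \<phi>])

text \<open>Positivity of \<open>\<phi>\<close> on \<open>(a + c)* (a + c)\<close> is exploited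
  without presupposing \<open>\<phi> 1 = 1\<close>, because states are defined by norm 1 and this
  estimate is what yields the normalisation.\<close>

lemma state_space_adjoint_bound:
  assumes A: "cstar_subalgebra A" and \<phi>: "\<phi> \<in> state_space A" and one: "id_blinfun \<in> A"
    and a: "a \<in> A" and b: "b \<in> A" and ab: "is_adjoint a b"
  shows "\<phi> id_blinfun \<in> \<real>" and "(cmod (\<phi> a))\<^sup>2 * (2 - Re (\<phi> id_blinfun)) \<le> (norm a)\<^sup>2"
proof -
  let ?e = "id_blinfun :: 'a l2 \<Rightarrow>\<^sub>L 'a l2"
  have bops: "a \<in> bounded_ops" "b \<in> bounded_ops" "?e \<in> bounded_ops"
    using a b one cstar_subalgebraD(1)[OF A] by auto
  note lin = state_space_linear[OF \<phi>]
  have "is_adjoint ?e ?e" by (simp add: is_adjoint_def)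
  moreover have "?e o\<^sub>L ?e = ?e" by (rule blinfun_eqI) simp
  ultimately have one_pos: "\<phi> ?e \<in> \<real>\<^sub>\<ge>\<^sub>0"
    using lin(3)[OF one one] by simp
  then show "\<phi> ?e \<in> \<real>" by (auto simp: complex_nonneg_Reals_iff complex_is_Real_iff)
  have pos: "\<phi> (b o\<^sub>L a) + c * \<phi> b + cnj c * \<phi> a + cnj c * c * \<phi> ?e \<in> \<real>\<^sub>\<ge>\<^sub>0" for c
  proof -
    let ?a = "a + (scalar_op c o\<^sub>L ?e)" and ?b = "b + (scalar_op (cnj c) o\<^sub>L ?e)"
    have mem: "?a \<in> A" "?b \<in> A"
      by (intro cstar_subalgebraD(4,5) A a b one)+
    have "is_adjoint ?a ?b"
    proof (rule is_adjointI)
      show "?a \<in> bounded_ops" "?b \<in> bounded_ops" using cstar_subalgebraD(1)[OF A] mem by auto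
      have "entry ?e g h = of_bool (g = h)" for g h by (simp add: entry_def unit_l2.rep_eq)
      then show "entry ?b g h = cnj (entry ?a h g)" for g h
        by (auto simp: entry_add entry_scalar_op is_adjoint_entry[OF ab, of g h])
    qed
    from lin(3)[OF mem this] have "\<phi> (?b o\<^sub>L ?a) \<in> \<real>\<^sub>\<ge>\<^sub>0" .
    also have "?b o\<^sub>L ?a = (b o\<^sub>L a) + (scalar_op c o\<^sub>L b) + (scalar_op (cnj c) o\<^sub>L a)
        + (scalar_op (cnj c * c) o\<^sub>L ?e)"
      using bops(2) unfolding bounded_ops_def
      by (intro blinfun_eqI l2_eqI) (simp add: blinfun.add_left blinfun.add_right plus_l2.rep_eq
          scalar_op.rep_eq scaleC_l2.rep_eq algebra_simps)
    also have "\<phi> \<dots> = \<phi> (b o\<^sub>L a) + c * \<phi> b + cnj c * \<phi> a + cnj c * c * \<phi> ?e"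
      using a b one cstar_subalgebraD(4-6)[OF A] by (simp add: lin(1,2))
    finally show ?thesis .
  qed
  have ba: "\<phi> (b o\<^sub>L a) \<in> \<real>\<^sub>\<ge>\<^sub>0" by (rule lin(3)[OF a b ab])
  \<comment> \<open>The values for \<open>c = 1\<close> and \<open>c = \<i>\<close> are real, which
    matches the imaginary and the real parts of \<open>\<phi> b\<close> and
    \<open>cnj (\<phi> a)\<close> respectively.\<close>
  have "\<phi> b = cnj (\<phi> a)"
    using pos[of 1] pos[of \<i>] ba one_pos by (simp add: complex_nonneg_Reals_iff complex_eq_iff)
  \<comment> \<open>The choice \<open>c = - \<phi> a\<close> is the minimiser when
    \<open>\<phi> 1 = 1\<close>; in general it leaves the factor
    \<open>2 - \<phi> 1\<close>.\<close>
  then have "0 \<le> Re (\<phi> (b o\<^sub>L a) - 2 * (\<phi> a * cnj (\<phi> a)) + \<phi> a * cnj (\<phi> a) * \<phi> ?e)"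
    using pos[of "- \<phi> a"] by (simp add: complex_nonneg_Reals_iff algebra_simps)
  then have "(cmod (\<phi> a))\<^sup>2 * (2 - Re (\<phi> ?e)) \<le> Re (\<phi> (b o\<^sub>L a))"
    by (simp add: complex_norm_square[symmetric] algebra_simps)
  also have "\<dots> \<le> norm (b o\<^sub>L a)"
    using state_space_norm_le[OF A \<phi> cstar_subalgebraD(6)[OF A b a]] complex_Re_le_cmod
    by (rule order_trans[rotated])
  also have "\<dots> \<le> norm b * norm a" by (rule norm_blinfun_compose)
  also have "\<dots> \<le> norm a * norm a"
    by (intro mult_right_mono norm_le_adjoint[OF bops(1,2) is_adjoint_entry[OF ab]]) simp
  finally show "(cmod (\<phi> a))\<^sup>2 * (2 - Re (\<phi> ?e)) \<le> (norm a)\<^sup>2"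
    by (simp add: power2_eq_square)
qed

lemma translation_op_zero: "translation_op 0 = id_blinfun"
  by (rule blinfun_eqI, rule l2_eqI) (simp add: translation_op.rep_eq translate.rep_eq)

lemma translation_op_reduced_cstar: "translation_op g \<in> reduced_cstar"
proof -
  have "scalar_op 1 o\<^sub>L translation_op g = translation_op g"
    using scaleR_blinfun_eq[of 1 "translation_op g"] by simp
  then show ?thesis
    using left_regular_reduced_cstar[of "Poly_Mapping.single g 1"] by (simp add: left_regular_single)
qed

text \<open>
  Adjoints are at hand only for \<open>\<lambda>(\<complex>G)\<close>; the Cauchy-Schwarz estimate extends to its closure by
  continuity, and contradicts \<open>\<parallel>\<phi>\<parallel> = 1\<close> unless \<open>\<phi>(1) \<ge> 1\<close>.
\<close>

lemma state_space_translation_op_zero: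
  assumes \<phi>: "\<phi> \<in> state_space (reduced_cstar :: ('g::group_add l2 \<Rightarrow>\<^sub>L 'g l2) set)"
  shows "\<phi> (translation_op 0) = 1"
proof -
  let ?A = "reduced_cstar :: ('g l2 \<Rightarrow>\<^sub>L 'g l2) set"
  note A = cstar_subalgebra_reduced_cstar
  note one = translation_op_reduced_cstar[of 0, unfolded translation_op_zero]
  define q where "q = Re (\<phi> id_blinfun)"
  have poly: "(cmod (\<phi> (left_regular x)))\<^sup>2 * (2 - q) \<le> (norm (left_regular x))\<^sup>2"
    and real: "\<phi> id_blinfun \<in> \<real>" for x
  proof -
    obtain y where y: "\<And>g h. entry (left_regular y) g h = cnj (entry (left_regular x) h g)"
      by (rule left_regular_adjoint[of x]) (rule that)
    have "is_adjoint (left_regular x) (left_regular y)"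
      using y by (intro is_adjointI left_regular_bounded_ops)
    from state_space_adjoint_bound[OF A \<phi> one left_regular_reduced_cstar left_regular_reduced_cstar this]
    show "(cmod (\<phi> (left_regular x)))\<^sup>2 * (2 - q) \<le> (norm (left_regular x))\<^sup>2" "\<phi> id_blinfun \<in> \<real>"
      by (simp_all add: q_def)
  qed
  have bound: "(cmod (\<phi> a))\<^sup>2 * (2 - q) \<le> (norm a)\<^sup>2" if a: "a \<in> ?A" for a
  proof -
    obtain f where f: "\<And>n. f n \<in> range left_regular" "f \<longlonglongrightarrow> a"
      using a unfolding reduced_cstar_eq_closure closure_sequential by blast
    have fA: "f n \<in> ?A" for n using f(1)[of n] left_regular_reduced_cstar by auto
    have "(\<lambda>n. \<phi> (f n)) \<longlonglongrightarrow> \<phi> a"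
    proof (rule Lim_null_comparison[THEN LIM_zero_cancel])
      show "\<forall>\<^sub>F n in sequentially. norm (\<phi> (f n) - \<phi> a) \<le> norm (f n - a)"
        using state_space_norm_le[OF A \<phi> cstar_subalgebra_diff[OF A fA a]]
        by (simp add: state_space_diff[OF A \<phi> fA a])
      show "(\<lambda>n. norm (f n - a)) \<longlonglongrightarrow> 0"
        using f(2) by (simp add: LIM_zero_iff tendsto_norm_zero)
    qed
    then have "(\<lambda>n. (cmod (\<phi> (f n)))\<^sup>2 * (2 - q)) \<longlonglongrightarrow> (cmod (\<phi> a))\<^sup>2 * (2 - q)"
      "(\<lambda>n. (norm (f n))\<^sup>2) \<longlonglongrightarrow> (norm a)\<^sup>2"
      by (intro tendsto_intros f(2); assumption)+
    moreover have "(cmod (\<phi> (f n)))\<^sup>2 * (2 - q) \<le> (norm (f n))\<^sup>2" for n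
      using f(1)[of n] poly by auto
    ultimately show ?thesis by (intro LIMSEQ_le) auto
  qed
  have "q \<le> cmod (\<phi> id_blinfun)" unfolding q_def by (rule complex_Re_le_cmod)
  also have "\<dots> \<le> norm (id_blinfun :: 'g l2 \<Rightarrow>\<^sub>L 'g l2)" by (rule state_space_norm_le[OF A \<phi> one])
  also have "\<dots> \<le> 1" by (rule norm_blinfun_id_le)
  finally have "q \<le> 1" .
  moreover have "\<not> q < 1"
  proof
    assume q: "q < 1"
    \<comment> \<open>As \<open>2 - q\<close> exceeds 1, this bound on the unit ball is uniform and
      strictly below 1.\<close>
    have "cmod (\<phi> a) \<le> 1 / sqrt (2 - q)" if "a \<in> ?A" "norm a \<le> 1" for a
    proof -
      have "(norm a)\<^sup>2 \<le> 1" using that by (simp add: abs_square_le_1)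
      then have "(cmod (\<phi> a))\<^sup>2 \<le> 1 / (2 - q)"
        using bound[OF that(1)] q by (simp add: pos_le_divide_eq)
      from real_sqrt_le_mono[OF this] show ?thesis by (simp add: real_sqrt_divide)
    qed
    then have "(SUP a\<in>{a \<in> ?A. norm a \<le> 1}. ennreal (cmod (\<phi> a))) \<le> ennreal (1 / sqrt (2 - q))"
      by (intro SUP_least ennreal_leI) auto
    also have "\<dots> < 1" using q by (simp add: ennreal_less_one_iff)
    finally show False using \<phi> by (simp add: state_space_def)
  qed
  ultimately have "q = 1" by simp
  then show ?thesis
    using real by (simp add: translation_op_zero q_def complex_eq_iff complex_is_Real_iff)
qed

lemma state_space_left_regular:
  assumes "\<phi> \<in> state_space reduced_cstar"
  shows "\<phi> (left_regular x) =
    (\<Sum>g\<in>Poly_Mapping.keys x. Poly_Mapping.lookup x g * \<phi> (translation_op g))"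
  unfolding left_regular_def
  by (simp add: state_space_sum[OF cstar_subalgebra_reduced_cstar assms] state_space_linear(2)[OF assms]
      cstar_subalgebraD(5)[OF cstar_subalgebra_reduced_cstar] translation_op_reduced_cstar)

text \<open>Replacing \<open>a\<close> by the group algebra element costs its distance once for each
  state, hence the factor 2. The term at the identity cancels because both states take the value 1
  there.\<close>

lemma state_space_diff_le:
  fixes a :: "'g::group_add l2 \<Rightarrow>\<^sub>L 'g l2"
  assumes \<phi>: "\<phi> \<in> state_space reduced_cstar" and \<psi>: "\<psi> \<in> state_space reduced_cstar"
    and a: "a \<in> reduced_cstar"
  shows "cmod (\<phi> a - \<psi> a) \<le> 2 * norm (a - left_regular x) + (\<Sum>g\<in>Poly_Mapping.keys x - {0}.
    cmod (Poly_Mapping.lookup x g) * cmod (\<phi> (translation_op g) - \<psi> (translation_op g)))"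
proof -
  note A = cstar_subalgebra_reduced_cstar
  let ?x = "left_regular x"
  have n: "cmod (\<theta> a - \<theta> ?x) \<le> norm (a - ?x)" if "\<theta> \<in> state_space reduced_cstar" for \<theta>
    using state_space_norm_le[OF A that cstar_subalgebra_diff[OF A a left_regular_reduced_cstar]]
    by (simp add: state_space_diff[OF A that a left_regular_reduced_cstar])
  have "\<phi> ?x - \<psi> ?x = (\<Sum>g\<in>Poly_Mapping.keys x.
      Poly_Mapping.lookup x g * (\<phi> (translation_op g) - \<psi> (translation_op g)))"
    by (simp add: state_space_left_regular \<phi> \<psi> right_diff_distrib sum_subtractf)
  also have "\<dots> = (\<Sum>g\<in>Poly_Mapping.keys x - {0}.
      Poly_Mapping.lookup x g * (\<phi> (translation_op g) - \<psi> (translation_op g)))"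
    by (rule sum.mono_neutral_right)
      (auto simp: state_space_translation_op_zero[OF \<phi>] state_space_translation_op_zero[OF \<psi>])
  finally have "cmod (\<phi> ?x - \<psi> ?x) \<le> (\<Sum>g\<in>Poly_Mapping.keys x - {0}.
      cmod (Poly_Mapping.lookup x g) * cmod (\<phi> (translation_op g) - \<psi> (translation_op g)))"
    using norm_sum[of "\<lambda>g. Poly_Mapping.lookup x g * (\<phi> (translation_op g) - \<psi> (translation_op g))"]
    by (simp add: norm_mult)
  moreover have "cmod (\<phi> a - \<psi> a) \<le>
      cmod (\<phi> a - \<phi> ?x) + cmod (\<psi> a - \<psi> ?x) + cmod (\<phi> ?x - \<psi> ?x)"
    by norm
  ultimately show ?thesis using n[OF \<phi>] n[OF \<psi>] by linarith
qed

lemma state_space_eqI: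
  assumes \<phi>: "\<phi> \<in> state_space reduced_cstar" and \<psi>: "\<psi> \<in> state_space reduced_cstar"
    and e: "\<And>g. \<phi> (translation_op g) = \<psi> (translation_op g)"
  shows "\<phi> = \<psi>"
proof (rule extensionalityI)
  show "\<phi> \<in> extensional reduced_cstar" "\<psi> \<in> extensional reduced_cstar"
    using \<phi> \<psi> by (auto simp: state_space_def)
  fix a :: "'a l2 \<Rightarrow>\<^sub>L 'a l2" assume a: "a \<in> reduced_cstar"
  have "cmod (\<phi> a - \<psi> a) \<le> 0"
  proof (rule field_le_epsilon)
    fix \<epsilon> :: real assume "0 < \<epsilon>"
    then have "0 < \<epsilon> / 2" by simp
    then obtain x where "dist (left_regular x) a < \<epsilon> / 2"
      using a unfolding reduced_cstar_eq_closure closure_approachable by blast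
    then have "2 * norm (a - left_regular x) \<le> \<epsilon>"
      by (simp add: dist_norm norm_minus_commute)
    with state_space_diff_le[OF \<phi> \<psi> a, of x] show "cmod (\<phi> a - \<psi> a) \<le> 0 + \<epsilon>"
      by (simp add: e)
  qed
  then show "\<phi> a = \<psi> a" by simp
qed

section \<open>The metric on the state space\<close>

locale lip_metric =
  fixes l :: "'g::group_add \<Rightarrow> real" and k :: nat and K :: real
  assumes len: "length_function l" and fin: "\<And>n. finite {g. l g \<le> real n}"
    and zero: "\<And>g. l g \<le> 0 \<Longrightarrow> g = 0" and K: "0 \<le> K"
    and approx: "\<And>a n. a \<in> lip_ball l k \<Longrightarrow> \<exists>x. norm (a - left_regular x) \<le> K / (real n + 1) \<and>
      Poly_Mapping.keys x \<subseteq> {g. l g \<le> real n} \<and>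
      (\<forall>g. g \<noteq> 0 \<longrightarrow> cmod (Poly_Mapping.lookup x g) \<le> 1)"
begin

abbreviation "S \<equiv> state_space (reduced_cstar :: ('g l2 \<Rightarrow>\<^sub>L 'g l2) set)"

abbreviation "d \<equiv> \<lambda>\<phi> \<psi>. enn2real (lip_dist l k \<phi> \<psi>)"

text \<open>The right side is independent of \<open>a\<close>: the tail is uniform over the Lip ball
  and the remaining coefficients have modulus at most 1.\<close>

lemma lip_ball_le:
  assumes \<phi>: "\<phi> \<in> S" and \<psi>: "\<psi> \<in> S" and a: "a \<in> lip_ball l k"
  shows "cmod (\<phi> a - \<psi> a) \<le> 2 * K / (real n + 1) +
    (\<Sum>g\<in>{g. l g \<le> real n} - {0}. cmod (\<phi> (translation_op g) - \<psi> (translation_op g)))"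
proof -
  let ?F = "{g. l g \<le> real n}"
  let ?d = "\<lambda>g. cmod (\<phi> (translation_op g) - \<psi> (translation_op g))"
  from approx[OF a, of n] obtain x where x: "norm (a - left_regular x) \<le> K / (real n + 1)"
    "Poly_Mapping.keys x \<subseteq> ?F" "\<forall>g. g \<noteq> 0 \<longrightarrow> cmod (Poly_Mapping.lookup x g) \<le> 1"
    by (elim exE conjE)
  have "a \<in> reduced_cstar" using a by (simp add: lip_ball_def lip_domain_def)
  from state_space_diff_le[OF \<phi> \<psi> this, of x]
  have "cmod (\<phi> a - \<psi> a) \<le> 2 * norm (a - left_regular x) +
      (\<Sum>g\<in>Poly_Mapping.keys x - {0}. cmod (Poly_Mapping.lookup x g) * ?d g)" .
  also have "\<dots> \<le> 2 * (K / (real n + 1)) + (\<Sum>g\<in>Poly_Mapping.keys x - {0}. 1 * ?d g)"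
    using x(1,3) by (intro add_mono mult_left_mono sum_mono mult_right_mono) auto
  also have "(\<Sum>g\<in>Poly_Mapping.keys x - {0}. 1 * ?d g) \<le> (\<Sum>g\<in>?F - {0}. ?d g)"
    unfolding mult_1_left using fin x(2) by (intro sum_mono2) auto
  finally show ?thesis by simp
qed

lemma lip_dist_leI:
  assumes "\<And>a. a \<in> lip_ball l k \<Longrightarrow> cmod (\<phi> a - \<psi> a) \<le> r"
  shows "lip_dist l k \<phi> \<psi> \<le> ennreal r"
  unfolding lip_dist_def using assms by (intro SUP_least ennreal_leI)

text \<open>For \<open>n = 0\<close> the finite sum is empty, since only the identity has length
  0.\<close>

lemma lip_dist_bounded:
  assumes "\<phi> \<in> S" "\<psi> \<in> S"
  shows "lip_dist l k \<phi> \<psi> \<le> ennreal (2 * K)"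
proof (rule lip_dist_leI)
  fix a assume a: "a \<in> lip_ball l k"
  have F: "{g. l g \<le> real 0} - {0} = {}" using zero by auto
  show "cmod (\<phi> a - \<psi> a) \<le> 2 * K"
    using lip_ball_le[OF assms a, of 0] unfolding F by simp
qed

text \<open>As \<open>enn2real\<close> sends infinity to 0, the supremum has to be known finite
  before it dominates its members as a real number.\<close>

lemma le_d:
  assumes "\<phi> \<in> S" "\<psi> \<in> S" "a \<in> lip_ball l k"
  shows "cmod (\<phi> a - \<psi> a) \<le> d \<phi> \<psi>"
proof -
  have "ennreal (cmod (\<phi> a - \<psi> a)) \<le> lip_dist l k \<phi> \<psi>"
    unfolding lip_dist_def using assms(3) by (rule SUP_upper)
  moreover have "lip_dist l k \<phi> \<psi> < top"
    using lip_dist_bounded[OF assms(1,2)] by (simp add: le_less_trans)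
  ultimately have "enn2real (ennreal (cmod (\<phi> a - \<psi> a))) \<le> d \<phi> \<psi>"
    by (intro enn2real_mono)
  then show ?thesis by simp
qed

lemma d_leI:
  assumes "0 \<le> r" "\<And>a. a \<in> lip_ball l k \<Longrightarrow> cmod (\<phi> a - \<psi> a) \<le> r"
  shows "d \<phi> \<psi> \<le> r"
  using enn2real_mono[OF lip_dist_leI[OF assms(2)]] assms(1) by simp

lemma translation_op_le_d:
  assumes \<phi>: "\<phi> \<in> S" and \<psi>: "\<psi> \<in> S"
  shows "cmod (\<phi> (translation_op g) - \<psi> (translation_op g)) \<le> (1 + l g) ^ k * d \<phi> \<psi>"
proof -
  have pos: "0 < (1 + l g) ^ k" using len by (simp add: length_function_def add_pos_nonneg)
  let ?c = "complex_of_real (1 / (1 + l g) ^ k)"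
  have "cmod (?c * (\<phi> (translation_op g) - \<psi> (translation_op g))) \<le> d \<phi> \<psi>"
    using le_d[OF \<phi> \<psi> translation_op_lip_ball[OF len, of g k]]
    by (simp only: state_space_linear(2)[OF \<phi> translation_op_reduced_cstar]
        state_space_linear(2)[OF \<psi> translation_op_reduced_cstar] right_diff_distrib)
  then have "1 / (1 + l g) ^ k * cmod (\<phi> (translation_op g) - \<psi> (translation_op g)) \<le> d \<phi> \<psi>"
    using pos by (simp only: norm_mult norm_of_real) simp
  then show ?thesis using pos by (simp add: divide_le_eq mult.commute)
qed

sublocale Metric_space S d
proof
  fix \<phi> \<psi> \<theta>
  show "0 \<le> d \<phi> \<psi>" by simp
  show "d \<phi> \<psi> = d \<psi> \<phi>" by (simp add: lip_dist_def norm_minus_commute)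
  assume \<phi>: "\<phi> \<in> S" and \<psi>: "\<psi> \<in> S"
  show "d \<phi> \<psi> = 0 \<longleftrightarrow> \<phi> = \<psi>"
  proof
    assume "d \<phi> \<psi> = 0"
    then show "\<phi> = \<psi>"
      using translation_op_le_d[OF \<phi> \<psi>] by (intro state_space_eqI \<phi> \<psi>) simp
  next
    assume "\<phi> = \<psi>"
    then have "d \<phi> \<psi> \<le> 0" by (intro d_leI) auto
    then show "d \<phi> \<psi> = 0" using enn2real_nonneg by (rule antisym)
  qed
  assume \<theta>: "\<theta> \<in> S"
  show "d \<phi> \<theta> \<le> d \<phi> \<psi> + d \<psi> \<theta>"
  proof (rule d_leI)
    fix a assume a: "a \<in> lip_ball l k"
    have "cmod (\<phi> a - \<theta> a) \<le> cmod (\<phi> a - \<psi> a) + cmod (\<psi> a - \<theta> a)" by norm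
    with le_d[OF \<phi> \<psi> a] le_d[OF \<psi> \<theta> a] show "cmod (\<phi> a - \<theta> a) \<le> d \<phi> \<psi> + d \<psi> \<theta>" by linarith
  qed simp
qed

section \<open>Comparison with the weak* topology\<close>

abbreviation "W \<equiv> weak_star_topology (reduced_cstar :: ('g l2 \<Rightarrow>\<^sub>L 'g l2) set)"

lemma topspace_weak_star: "topspace W = S"
  by (auto simp: weak_star_topology_def PiE_UNIV_domain state_space_def PiE_def)

lemma continuous_map_weak_star_eval:
  assumes "a \<in> reduced_cstar"
  shows "continuous_map W euclidean (\<lambda>\<phi>. \<phi> a)"
  unfolding weak_star_topology_def
  using assms by (intro continuous_map_from_subtopology continuous_map_product_projection)

lemma continuous_map_weak_star_mtopology: "continuous_map W mtopology (\<lambda>\<phi>. \<phi>)"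
  unfolding continuous_map_to_metric topspace_weak_star
proof (intro ballI allI impI)
  fix \<phi> and \<epsilon> :: real
  assume \<phi>: "\<phi> \<in> S" and \<epsilon>: "0 < \<epsilon>"
  \<comment> \<open>The radius \<open>n\<close> makes the uniform tail smaller than
    \<open>\<epsilon> / 2\<close>. The other half is left for \<open>h\<close>, which involves
    finitely many evaluations and is therefore weak* continuous.\<close>
  obtain n where n: "2 * K / (real n + 1) < \<epsilon> / 2"
  proof -
    obtain n where "4 * K / \<epsilon> < real n" using reals_Archimedean2 by blast
    then have "2 * K / (real n + 1) < \<epsilon> / 2" using \<epsilon> by (simp add: field_simps)
    then show ?thesis by (rule that)
  qed
  let ?F = "{g. l g \<le> real n} - {0}"
  define h where "h \<psi> = (\<Sum>g\<in>?F. cmod (\<phi> (translation_op g) - \<psi> (translation_op g)))" for \<psi>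
  have "continuous_map W euclidean h"
    unfolding h_def using fin
    by (intro continuous_map_sum continuous_map_norm continuous_map_diff
        continuous_map_weak_star_eval translation_op_reduced_cstar continuous_map_const[THEN iffD2]) auto
  then have "openin W {\<psi> \<in> topspace W. h \<psi> \<in> {..< \<epsilon> / 2}}"
    by (rule openin_continuous_map_preimage) simp
  moreover have "\<phi> \<in> {\<psi> \<in> topspace W. h \<psi> \<in> {..< \<epsilon> / 2}}"
    using \<phi> \<epsilon> by (simp add: topspace_weak_star h_def)
  moreover have "\<psi> \<in> mball \<phi> \<epsilon>" if "\<psi> \<in> {\<psi> \<in> topspace W. h \<psi> \<in> {..< \<epsilon> / 2}}" for \<psi>
  proof -
    have \<psi>: "\<psi> \<in> S" and h: "h \<psi> < \<epsilon> / 2" using that by (auto simp: topspace_weak_star)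
    have "d \<phi> \<psi> \<le> 2 * K / (real n + 1) + h \<psi>"
      using lip_ball_le[OF \<phi> \<psi>, of _ n] K
      by (intro d_leI) (auto simp: h_def intro!: add_nonneg_nonneg sum_nonneg)
    then show ?thesis using h n \<phi> \<psi> by (simp add: in_mball)
  qed
  ultimately show "\<exists>U. openin W U \<and> \<phi> \<in> U \<and> (\<forall>\<psi>\<in>U. \<psi> \<in> mball \<phi> \<epsilon>)" by blast
qed

lemma continuous_map_mtopology_eval:
  fixes a :: "'g l2 \<Rightarrow>\<^sub>L 'g l2"
  assumes a: "a \<in> reduced_cstar"
  shows "continuous_map mtopology euclidean (\<lambda>\<phi>. \<phi> a)"
  unfolding continuous_map_def topspace_mtopology openin_mtopology
proof (intro conjI allI impI)
  fix U :: "complex set" and \<phi>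
  assume U: "openin euclidean U" and "\<phi> \<in> {\<phi> \<in> S. \<phi> a \<in> U}"
  then have \<phi>: "\<phi> \<in> S" and "\<phi> a \<in> U" by auto
  then obtain e where e: "0 < e" "ball (\<phi> a) e \<subseteq> U"
    using U by (auto simp: open_contains_ball)
  \<comment> \<open>The approximation error is doubled by \<open>state_space_diff_le\<close> and
    then takes up half of \<open>e\<close>.\<close>
  then have "0 < e / 4" by simp
  then obtain x where x: "dist (left_regular x) a < e / 4"
    using a unfolding reduced_cstar_eq_closure closure_approachable by blast
  \<comment> \<open>\<open>M\<close> is a Lipschitz constant with respect to \<open>d\<close> for
    evaluation of states at \<open>left_regular x\<close>. The radius below uses
    \<open>M + 1\<close> so that the denominator is positive when \<open>M = 0\<close>.\<close>
  define M where "M = (\<Sum>g\<in>Poly_Mapping.keys x - {0}. cmod (Poly_Mapping.lookup x g) * (1 + l g) ^ k)"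
  have M: "0 \<le> M"
    using len by (auto simp: M_def length_function_def intro!: sum_nonneg mult_nonneg_nonneg)
  show "\<exists>r>0. mball \<phi> r \<subseteq> {\<phi> \<in> S. \<phi> a \<in> U}"
  proof (intro exI conjI subsetI)
    show "0 < e / (2 * (M + 1))" using e M by simp
    fix \<psi> assume "\<psi> \<in> mball \<phi> (e / (2 * (M + 1)))"
    then have \<psi>: "\<psi> \<in> S" and d: "d \<phi> \<psi> < e / (2 * (M + 1))" by (auto simp: in_mball)
    have "cmod (\<phi> a - \<psi> a) \<le> 2 * norm (a - left_regular x) + (\<Sum>g\<in>Poly_Mapping.keys x - {0}.
        cmod (Poly_Mapping.lookup x g) * cmod (\<phi> (translation_op g) - \<psi> (translation_op g)))"
      by (rule state_space_diff_le[OF \<phi> \<psi> a])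
    also have "\<dots> \<le> 2 * norm (a - left_regular x) + (\<Sum>g\<in>Poly_Mapping.keys x - {0}.
        cmod (Poly_Mapping.lookup x g) * ((1 + l g) ^ k * d \<phi> \<psi>))"
      by (intro add_left_mono sum_mono mult_left_mono translation_op_le_d \<phi> \<psi>) simp
    also have "\<dots> = 2 * norm (a - left_regular x) + M * d \<phi> \<psi>"
      by (simp add: M_def sum_distrib_right mult.assoc)
    also have "\<dots> < e / 2 + e / 2"
    proof (rule add_less_le_mono)
      show "2 * norm (a - left_regular x) < e / 2"
        using x by (simp add: dist_norm norm_minus_commute)
      have "M * d \<phi> \<psi> \<le> (M + 1) * (e / (2 * (M + 1)))"
        using d M by (intro mult_mono) auto
      also have "\<dots> = e / 2" using M by (simp add: field_simps)
      finally show "M * d \<phi> \<psi> \<le> e / 2" .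
    qed
    finally have "\<psi> a \<in> ball (\<phi> a) e" by (simp add: dist_norm)
    then show "\<psi> \<in> {\<phi> \<in> S. \<phi> a \<in> U}" using e(2) \<psi> by auto
  qed
qed auto

lemma continuous_map_mtopology_weak_star: "continuous_map mtopology W (\<lambda>\<phi>. \<phi>)"
  unfolding weak_star_topology_def continuous_map_in_subtopology continuous_map_componentwise
  using continuous_map_mtopology_eval by (auto dest: state_space_extensional)

lemma mtopology_eq_weak_star: "mtopology = W"
proof (rule topology_eq[THEN iffD2], intro allI iffI)
  fix U
  show "openin W U" if U: "openin mtopology U"
  proof -
    have "{\<phi> \<in> topspace W. \<phi> \<in> U} = U"
      using openin_subset[OF U] by (auto simp: topspace_weak_star)
    then show ?thesis
      using openin_continuous_map_preimage[OF continuous_map_weak_star_mtopology U] by simp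
  qed
  show "openin mtopology U" if U: "openin W U"
  proof -
    have "{\<phi> \<in> topspace mtopology. \<phi> \<in> U} = U"
      using openin_subset[OF U] by (auto simp: topspace_weak_star)
    then show ?thesis
      using openin_continuous_map_preimage[OF continuous_map_mtopology_weak_star U] by simp
  qed
qed

end

theorem theorem4p3:
  fixes l :: "'g::group_add \<Rightarrow> real"
  assumes "length_function l"
    and "range l \<subseteq> \<nat>"
    and "l -` {0} = {0}"
    and "proper_length l"
    and "rapid_decay l"
  shows "\<exists>k0\<ge>1. \<forall>k\<ge>k0.
    lip_lower_semicontinuous l k \<and>
    (\<exists>B::real. \<forall>\<phi>\<in>state_space reduced_cstar. \<forall>\<psi>\<in>state_space reduced_cstar.
       lip_dist l k \<phi> \<psi> \<le> ennreal B) \<and>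
    Metric_space (state_space reduced_cstar) (\<lambda>\<phi> \<psi>. enn2real (lip_dist l k \<phi> \<psi>)) \<and>
    Metric_space.mtopology (state_space reduced_cstar) (\<lambda>\<phi> \<psi>. enn2real (lip_dist l k \<phi> \<psi>)) =
      weak_star_topology reduced_cstar"
proof -
  obtain K k0 where K: "0 \<le> K" and k0: "1 \<le> k0"
    and approx: "\<And>k a n. k0 \<le> k \<Longrightarrow> a \<in> lip_ball l k \<Longrightarrow>
      \<exists>x. norm (a - left_regular x) \<le> K / (real n + 1) \<and>
        Poly_Mapping.keys x \<subseteq> {g. l g \<le> real n} \<and>
        (\<forall>g. g \<noteq> 0 \<longrightarrow> cmod (Poly_Mapping.lookup x g) \<le> 1)"
    by (rule lip_ball_approx[OF assms]) (rule that)
  have pos: "0 \<le> l g" for g using assms(1) by (simp add: length_function_def)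
  have "lip_metric l k K" if "k0 \<le> k" for k
  proof
    show "length_function l" "0 \<le> K" by fact+
    show "g = 0" if "l g \<le> 0" for g
      using that pos[of g] assms(3) by (auto simp: vimage_def)
    show "finite {g. l g \<le> real n}" for n
    proof (rule finite_subset)
      show "finite (l -` {0..real n + 1})" using assms(4) by (simp add: proper_length_def)
      show "{g. l g \<le> real n} \<subseteq> l -` {0..real n + 1}" by (auto simp: pos)
    qed
    show "\<exists>x. norm (a - left_regular x) \<le> K / (real n + 1) \<and>
        Poly_Mapping.keys x \<subseteq> {g. l g \<le> real n} \<and>
        (\<forall>g. g \<noteq> 0 \<longrightarrow> cmod (Poly_Mapping.lookup x g) \<le> 1)" if "a \<in> lip_ball l k" for a n
      using approx[OF \<open>k0 \<le> k\<close> that] .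
  qed
  note metric = this
  show ?thesis
  proof (intro exI[of _ k0] conjI allI impI k0)
    fix k assume "k0 \<le> k"
    then interpret lip_metric l k K by (rule metric)
    show "lip_lower_semicontinuous l k"
      by (rule lip_lower_semicontinuous[OF cstar_subalgebraD(1)[OF cstar_subalgebra_reduced_cstar]])
    show "\<exists>B::real. \<forall>\<phi>\<in>state_space reduced_cstar. \<forall>\<psi>\<in>state_space reduced_cstar.
        lip_dist l k \<phi> \<psi> \<le> ennreal B"
      using lip_dist_bounded by blast
    show "Metric_space (state_space reduced_cstar) (\<lambda>\<phi> \<psi>. enn2real (lip_dist l k \<phi> \<psi>))"
      by (rule Metric_space_axioms)
    show "Metric_space.mtopology (state_space reduced_cstar)
        (\<lambda>\<phi> \<psi>. enn2real (lip_dist l k \<phi> \<psi>)) = weak_star_topology reduced_cstar"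
      by (rule mtopology_eq_weak_star)
  qed
qed

end
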